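(* Let $d\ge 2$ be an integer, let $A,B,C,D$ be quantum systems each with Hilbert space $\mathbb{C}^d$, and let $|\phi\rangle_{AB}\in\mathbb{C}^d\otimes\mathbb{C}^d$ and $|\psi\rangle_{CD}\in\mathbb{C}^d\otimes\mathbb{C}^d$ be pure states (unit vectors). Assume that $|\phi\rangle_{AB}$ and $|\psi\rangle_{CD}$ have the same Schmidt coefficients, or that at least one of $|\phi\rangle_{AB}$, $|\psi\rangle_{CD}$ is maximally entangled. Put $|\Phi\rangle_{ABCD}=|\phi\rangle_{AB}\otimes|\psi\rangle_{CD}$ and $\rho_{AC}=\mathrm{tr}_{BD}\,|\Phi\rangle_{ABCD}\langle\Phi|$. Then $$\mathcal{N}^a(\rho_{AC})\ \geq\ \mathcal{N}_c\left(|\phi\rangle_{AB}\right)\,\mathcal{N}_c\left(|\psi\rangle_{CD}\right).$$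
   Context: For a state (density matrix) $\rho_{XY}$ on $\mathbb{C}^d\otimes\mathbb{C}^d$ ($d\ge 2$), the negativity is $\mathcal{N}(\rho_{XY})=\dfrac{\|\rho_{XY}^{T_Y}\|_1-1}{d-1}$, where $\|\cdot\|_1$ is the trace norm and $T_Y$ denotes partial transposition on the second factor. For a pure state with Schmidt decomposition $\sum_{i=0}^{d-1}\sqrt{\lambda_i}\,|e_i\rangle|f_i\rangle$ ($\lambda_i\ge 0$, $\sum_i\lambda_i=1$, orthonormal bases $(e_i)$, $(f_i)$), this equals $\frac{2}{d-1}\sum_{i<j}\sqrt{\lambda_i\lambda_j}$. Two pure states have the same Schmidt coefficients if their families $(\lambda_0,\ldots,\lambda_{d-1})$ agree (up to reordering, which only amounts to relabelling the Schmidt bases). A pure state on $\mathbb{C}^d\otimes\mathbb{C}^d$ is maximally entangled if $\lambda_i=1/d$ for all $i$. The convex-roof extended negativity (CREN) is $\mathcal{N}_c(\rho_{XY})=\min\sum_k p_k\,\mathcal{N}(|\psi_k\rangle_{XY})$ and the negativity of assistance (NoA) is $\mathcal{N}^a(\rho_{XY})=\max\sum_k p_k\,\mathcal{N}(|\psi_k\rangle_{XY})$, where the minimum, respectively maximum, is over all pure-state decompositions $\rho_{XY}=\sum_k p_k|\psi_k\rangle\langle\psi_k|$ (finite ensembles with $p_k\ge 0$, $\sum_k p_k=1$, $|\psi_k\rangle$ unit vectors). For a pure state, $\mathcal{N}_c=\mathcal{N}=\mathcal{N}^a$. The state $\rho_{AC}$ is regarded as a bipartite state with respect to the splitting $A|C$.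 The quantity $\mathcal{N}^a(\rho_{AC})$ is what is called the possible remotely-distributed entanglement onto $AC$ by joint measurement on $BD$. *)

theory Defs
  imports "HOL-Analysis.Analysis"
begin

text \<open>
  A system with Hilbert space $\mathbb{C}^d$ is modelled by vectors indexed by a finite type,
  with $d$ its cardinality; the tensor product of two such spaces is indexed by the product type.
  Operators are matrices in the computational basis.
\<close>

definition cinner :: "complex^'m::finite \<Rightarrow> complex^'m \<Rightarrow> complex" where
  "cinner x y = (\<Sum>i\<in>UNIV. cnj (x $ i) * y $ i)"

definition tensor :: "complex^'a::finite \<Rightarrow> complex^'b::finite \<Rightarrow> complex^('a \<times> 'b)" where
  "tensor x y = (\<chi> ij. x $ fst ij * y $ snd ij)"

definition ket_bra :: "complex^'m::finite \<Rightarrow> complex^'m^'m" where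
  "ket_bra x = (\<chi> i j. x $ i * cnj (x $ j))"

definition conj_transpose :: "complex^'m::finite^'m \<Rightarrow> complex^'m^'m" where
  "conj_transpose A = (\<chi> i j. cnj (A $ j $ i))"

definition psd :: "complex^'m::finite^'m \<Rightarrow> bool" where
  "psd A \<longleftrightarrow> conj_transpose A = A \<and> (\<forall>x. 0 \<le> Re (cinner x (A *v x)))"

definition psd_sqrt :: "complex^'m::finite^'m \<Rightarrow> complex^'m^'m" where
  "psd_sqrt A = (THE P. psd P \<and> P ** P = A)"

definition trace_norm :: "complex^'m::finite^'m \<Rightarrow> real" where
  "trace_norm A = Re (trace (psd_sqrt (conj_transpose A ** A)))"

definition partial_transpose ::
    "complex^('a::finite \<times> 'b::finite)^('a \<times> 'b) \<Rightarrow> complex^('a \<times> 'b)^('a \<times> 'b)" where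
  "partial_transpose \<rho> = (\<chi> r s. \<rho> $ (fst r, snd s) $ (fst s, snd r))"

definition negativity :: "complex^('n::finite \<times> 'n)^('n \<times> 'n) \<Rightarrow> real" where
  "negativity \<rho> = (trace_norm (partial_transpose \<rho>) - 1) / (real CARD('n) - 1)"

text \<open>
  The four tensor factors $A,B,C,D$ are grouped as $(A\otimes B)\otimes(C\otimes D)$; the second
  factor of each group is traced out.
\<close>

definition partial_trace_BD ::
    "complex^(('a::finite \<times> 'b::finite) \<times> ('c::finite \<times> 'd::finite))^(('a \<times> 'b) \<times> ('c \<times> 'd))
      \<Rightarrow> complex^('a \<times> 'c)^('a \<times> 'c)" where
  "partial_trace_BD M = (\<chi> r s. \<Sum>b\<in>UNIV. \<Sum>d\<in>UNIV.
     M $ ((fst r, b), (snd r, d)) $ ((fst s, b), (snd s, d)))"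

text \<open>
  An orthonormal family indexed by the coordinate type of the space is automatically a basis.
\<close>

definition orthonormal_basis :: "('n::finite \<Rightarrow> complex^'n) \<Rightarrow> bool" where
  "orthonormal_basis e \<longleftrightarrow> (\<forall>i j. cinner (e i) (e j) = (if i = j then 1 else 0))"

definition schmidt_coefficients :: "complex^('n::finite \<times> 'n) \<Rightarrow> ('n \<Rightarrow> real) \<Rightarrow> bool" where
  "schmidt_coefficients \<phi> l \<longleftrightarrow>
     (\<forall>i. 0 \<le> l i) \<and> (\<Sum>i\<in>UNIV. l i) = 1 \<and>
     (\<exists>e f. orthonormal_basis e \<and> orthonormal_basis f \<and>
        \<phi> = (\<Sum>i\<in>UNIV. sqrt (l i) *\<^sub>R tensor (e i) (f i)))"

definition same_schmidt_coefficients ::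
    "complex^('n::finite \<times> 'n) \<Rightarrow> complex^('n \<times> 'n) \<Rightarrow> bool" where
  "same_schmidt_coefficients \<phi> \<psi> \<longleftrightarrow>
     (\<exists>l m \<pi>. schmidt_coefficients \<phi> l \<and> schmidt_coefficients \<psi> m \<and> bij \<pi> \<and> m = l \<circ> \<pi>)"

definition maximally_entangled :: "complex^('n::finite \<times> 'n) \<Rightarrow> bool" where
  "maximally_entangled \<phi> \<longleftrightarrow> schmidt_coefficients \<phi> (\<lambda>i. 1 / real CARD('n))"

definition pure_decomposition ::
    "complex^'m::finite^'m \<Rightarrow> nat \<Rightarrow> (nat \<Rightarrow> real) \<Rightarrow> (nat \<Rightarrow> complex^'m) \<Rightarrow> bool" where
  "pure_decomposition \<rho> K p \<psi> \<longleftrightarrow>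
     (\<forall>k<K. 0 \<le> p k \<and> norm (\<psi> k) = 1) \<and> (\<Sum>k<K. p k) = 1 \<and>
     \<rho> = (\<Sum>k<K. p k *\<^sub>R ket_bra (\<psi> k))"

definition average_negativities :: "complex^('n::finite \<times> 'n)^('n \<times> 'n) \<Rightarrow> real set" where
  "average_negativities \<rho> =
     {\<Sum>k<K. p k * negativity (ket_bra (\<psi> k)) | K p \<psi>. pure_decomposition \<rho> K p \<psi>}"

text \<open>
  The two quantities below are a minimum and a maximum over an infinite set, hence \<open>LEAST\<close> and
  \<open>GREATEST\<close>: unlike \<open>Inf\<close> and \<open>Sup\<close>, they have the intended value only where the extremum
  is attained.
\<close>

definition cren :: "complex^('n::finite \<times> 'n)^('n \<times> 'n) \<Rightarrow> real" where
  "cren \<rho> = (LEAST x. x \<in> average_negativities \<rho>)"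

definition noa :: "complex^('n::finite \<times> 'n)^('n \<times> 'n) \<Rightarrow> real" where
  "noa \<rho> = (GREATEST x. x \<in> average_negativities \<rho>)"

end

theory Submission
  imports Defs
begin

text \<open>
  A pure state on \<open>\<complex>\<^sup>d \<otimes> \<complex>\<^sup>d\<close> is a \<open>d \<times> d\<close> matrix \<open>M\<close>; its negativity is
  \<open>(\<parallel>M\<parallel>\<^sub>1\<^sup>2 - 1) / (d - 1)\<close> with the nuclear norm \<open>\<parallel>M\<parallel>\<^sub>1\<close>, because the square root of
  \<open>N\<^sup>* N\<close>, for the partial transpose \<open>N\<close> of the state, is a Kronecker product of the two
  polar parts of \<open>M\<close>. Measuring \<open>BD\<close> in an orthonormal basis \<open>(B\<^sub>k)\<close>, again viewed as
  matrices, decomposes \<open>\<rho>\<^sub>A\<^sub>C\<close> into the unnormalized pure states \<open>\<Phi> B\<^sub>k \<Psi>\<^sup>T\<close>, so that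
  \<open>(\<Sum>\<^sub>k \<parallel>\<Phi> B\<^sub>k \<Psi>\<^sup>T\<parallel>\<^sub>1\<^sup>2 - 1) / (d - 1)\<close> is an average negativity. For a Bell basis adapted to the
  Schmidt bases the sum is at least \<open>\<Sum>\<^sub>a c\<^sub>a\<^sup>2\<close>, where
  \<open>c\<^sub>a = \<Sum>\<^sub>i (\<lambda>\<^sub>i \<mu>\<^sub>i\<^sub>+\<^sub>a)\<^sup>1\<^sup>/\<^sup>2\<close>. If \<open>\<lambda> = \<mu>\<close> then \<open>c\<^sub>0 = 1\<close>, and the Cauchy-Schwarz inequality
  for the remaining \<open>d - 1\<close> terms gives the claim. If one state is maximally entangled, all matrices
  \<open>\<Phi> B\<^sub>k \<Psi>\<^sup>T\<close> have the nuclear norm of the other state up to the factor \<open>1 / d\<close>.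
\<close>

section \<open>The nuclear norm and the polar decomposition\<close>

definition unitary :: "complex^'n::finite^'n \<Rightarrow> bool" where
  "unitary U \<longleftrightarrow> conj_transpose U ** U = mat 1"

text \<open>The trace norm in dual form: the supremum is the sum of the singular values of
  \<open>A\<close>. Lower bounds come from inserting one suitable unitary, upper bounds from
  estimating all of them.\<close>

definition nuclear_norm :: "complex^'n::finite^'n \<Rightarrow> real" where
  "nuclear_norm A = (SUP U\<in>{U. unitary U}. Re (trace (U ** A)))"

lemma conj_transpose_nth [simp]: "conj_transpose A $ i $ j = cnj (A $ j $ i)"
  by (simp add: conj_transpose_def)

lemma ket_bra_nth [simp]: "ket_bra x $ i $ j = x $ i * cnj (x $ j)"
  by (simp add: ket_bra_def)

lemma conj_transpose_conj_transpose [simp]: "conj_transpose (conj_transpose A) = A"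
  by (simp add: vec_eq_iff)

lemma conj_transpose_mul: "conj_transpose (A ** B) = conj_transpose B ** conj_transpose A"
  by (simp add: vec_eq_iff matrix_matrix_mult_def mult.commute)

lemma conj_transpose_add: "conj_transpose (A + B) = conj_transpose A + conj_transpose B"
  by (simp add: vec_eq_iff)

lemma conj_transpose_diff: "conj_transpose (A - B) = conj_transpose A - conj_transpose B"
  by (simp add: vec_eq_iff)

lemma conj_transpose_mat_1 [simp]: "conj_transpose (mat 1) = mat 1"
  by (simp add: vec_eq_iff mat_def)

lemma trace_conj_transpose: "trace (conj_transpose A) = cnj (trace A)"
  by (simp add: trace_def)

lemma cinner_adjoint: "cinner x (A *v y) = cinner (conj_transpose A *v x) y"
  unfolding cinner_def matrix_vector_mult_def
  by (simp add: sum_distrib_left sum_distrib_right mult_ac) (rule sum.swap)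

lemma cinner_commute: "cinner y x = cnj (cinner x y)"
  by (simp add: cinner_def mult.commute)

lemma cinner_add_left: "cinner (x + y) z = cinner x z + cinner y z"
  by (simp add: cinner_def algebra_simps sum.distrib)

lemma cinner_add_right: "cinner x (y + z) = cinner x y + cinner x z"
  by (simp add: cinner_def algebra_simps sum.distrib)

lemma cinner_diff_right: "cinner x (y - z) = cinner x y - cinner x z"
  by (simp add: cinner_def algebra_simps sum_subtractf)

lemma cinner_scale_left: "cinner (c *s x) y = cnj c * cinner x y"
  by (simp add: cinner_def sum_distrib_left mult_ac)

lemma cinner_scale_right: "cinner x (c *s y) = c * cinner x y"
  by (simp add: cinner_def sum_distrib_left mult_ac)

lemma cinner_self: "cinner x x = of_real ((norm x)\<^sup>2)"
  unfolding cinner_def norm_vec_def L2_set_def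
  by (simp add: sum_nonneg) (simp only: complex_norm_square mult.commute flip: of_real_power)

lemma ket_bra_mult: "ket_bra u *v x = cinner u x *s u"
  by (simp add: vec_eq_iff matrix_vector_mult_def cinner_def sum_distrib_left mult_ac)

lemma cinner_ket_bra: "cinner x (ket_bra u *v x) = of_real ((norm (cinner u x))\<^sup>2)"
  by (simp only: ket_bra_mult cinner_scale_right cinner_commute[of x u] complex_norm_square)

lemma cinner_axis: "cinner (axis i 1) x = x $ i"
proof -
  have "cinner (axis i 1) x = (\<Sum>j\<in>UNIV. if j = i then x $ j else 0)"
    unfolding cinner_def by (rule sum.cong) (auto simp: axis_def)
  then show ?thesis by simp
qed

lemma matrix_vector_mul_axis: "(A *v axis j 1) $ i = (A::complex^'n::finite^'m) $ i $ j"
proof -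
  have "(A *v axis j 1) $ i = (\<Sum>k\<in>UNIV. if k = j then A $ i $ k else 0)"
    unfolding matrix_vector_mult_def vec_lambda_beta by (rule sum.cong) (auto simp: axis_def)
  then show ?thesis by simp
qed

lemma matrix_matrix_add_rdistrib:
  "((A::'a::semiring_1^'n^'m) + B) ** C = A ** C + B ** C"
  by (simp add: vec_eq_iff matrix_matrix_mult_def distrib_right sum.distrib)

lemma unitary_mul: "unitary U \<Longrightarrow> unitary V \<Longrightarrow> unitary (U ** V)"
  unfolding unitary_def conj_transpose_mul
  by (metis matrix_mul_assoc matrix_mul_lid)

lemma unitary_right: "unitary U \<Longrightarrow> U ** conj_transpose U = mat 1"
  unfolding unitary_def using matrix_left_right_inverse by blast

lemma unitary_conj_transpose: "unitary U \<Longrightarrow> unitary (conj_transpose U)"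
  by (simp add: unitary_def unitary_right)

lemma unitary_mat_1: "unitary (mat 1)"
  by (simp add: unitary_def)

lemma unitary_transpose: "unitary U \<Longrightarrow> unitary (transpose U)"
proof -
  assume "unitary U"
  then have "U ** conj_transpose U = mat 1" by (rule unitary_right)
  then have "transpose (U ** conj_transpose U) = mat 1" by (simp add: transpose_mat)
  moreover have "transpose (conj_transpose U) = conj_transpose (transpose U)"
    by (simp add: vec_eq_iff transpose_def)
  ultimately show ?thesis by (simp add: unitary_def matrix_transpose_mul)
qed

lemma unitary_entry_le: assumes "unitary U" shows "norm (U $ i $ j) \<le> 1"
proof -
  have "(conj_transpose U ** U) $ j $ j = 1" using assms by (simp add: unitary_def mat_def)
  then have "(\<Sum>k\<in>UNIV. cnj (U $ k $ j) * U $ k $ j) = 1" by (simp add: matrix_matrix_mult_def)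
  then have "complex_of_real (\<Sum>k\<in>UNIV. (norm (U $ k $ j))\<^sup>2) = of_real 1"
    by (simp only: of_real_sum complex_norm_square mult.commute) simp
  then have "(\<Sum>k\<in>UNIV. (norm (U $ k $ j))\<^sup>2) = 1" using of_real_eq_iff by blast
  moreover have "(norm (U $ i $ j))\<^sup>2 \<le> (\<Sum>k\<in>UNIV. (norm (U $ k $ j))\<^sup>2)"
    by (rule member_le_sum) auto
  ultimately show ?thesis by (simp add: power_le_one_iff abs_square_le_1)
qed

text \<open>The columns are unit vectors, which bounds the entries, and the defining equation is
  closed. Compactness lets the supremum in \<open>nuclear_norm\<close> be attained.\<close>

lemma compact_unitary: "compact {U::complex^'n::finite^'n. unitary U}"
proof -
  have "bounded {U::complex^'n^'n. unitary U}"
  proof (rule boundedI)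
    fix U :: "complex^'n^'n" assume "U \<in> {U. unitary U}"
    then have u: "norm (U $ i $ j) \<le> 1" for i j by (auto intro: unitary_entry_le)
    have r: "norm (U $ i) \<le> real CARD('n)" for i
    proof -
      have "norm (U $ i) \<le> (\<Sum>j\<in>UNIV. norm (U $ i $ j))" by (simp add: norm_vec_def L2_set_le_sum)
      also have "\<dots> \<le> (\<Sum>j\<in>(UNIV::'n set). 1)" by (intro sum_mono u)
      finally show ?thesis by simp
    qed
    have "norm U \<le> (\<Sum>i\<in>UNIV. norm (U $ i))" by (simp add: norm_vec_def L2_set_le_sum)
    also have "\<dots> \<le> (\<Sum>i\<in>(UNIV::'n set). real CARD('n))" by (intro sum_mono r)
    finally show "norm U \<le> (\<Sum>i\<in>(UNIV::'n set). real CARD('n))" .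
  qed
  moreover have "closed {U::complex^'n^'n. unitary U}"
    unfolding unitary_def matrix_matrix_mult_def conj_transpose_def
    by (intro closed_Collect_eq continuous_intros)
  ultimately show ?thesis by (simp add: compact_eq_bounded_closed)
qed

text \<open>The matrix multiplies \<open>v\<close> by the phase \<open>z\<close> and fixes the
  orthogonal complement of \<open>v\<close>.\<close>

lemma unitary_rank_one:
  assumes "norm v = 1" "norm z = 1"
  shows "unitary (mat 1 + (\<chi> i j. (z - 1) * (v $ i * cnj (v $ j))))"
proof -
  have s: "(\<Sum>k\<in>UNIV. cnj (v $ k) * v $ k) = 1"
    using cinner_self[of v] assms by (simp add: cinner_def)
  have z: "cnj z * z = 1" using assms by (metis complex_norm_square mult.commute of_real_1 power_one)
  let ?R = "\<chi> i j. (z - 1) * (v $ i * cnj (v $ j))"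
  have "conj_transpose ?R ** ?R = (\<chi> i j. ((cnj z - 1) * (z - 1)) * (v $ i * cnj (v $ j)))"
  proof (simp add: vec_eq_iff matrix_matrix_mult_def, intro allI)
    fix i j
    have "(\<Sum>k\<in>UNIV. (cnj z - 1) * (cnj (v $ k) * v $ i) * ((z - 1) * (v $ k * cnj (v $ j))))
      = (cnj z - 1) * (z - 1) * (v $ i * cnj (v $ j)) * (\<Sum>k\<in>UNIV. cnj (v $ k) * v $ k)"
      by (subst sum_distrib_left) (simp add: mult_ac)
    then show "(\<Sum>k\<in>UNIV. (cnj z - 1) * (cnj (v $ k) * v $ i) * ((z - 1) * (v $ k * cnj (v $ j))))
      = (cnj z - 1) * (z - 1) * (v $ i * cnj (v $ j))" by (simp add: s)
  qed
  \<comment> \<open>Because \<open>z\<close> has modulus 1, the quadratic term of the product with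
    the adjoint cancels the two linear terms.\<close>
  moreover have "(cnj z - 1) * (z - 1) = - (cnj z - 1) - (z - 1)" by (simp add: algebra_simps z[simplified mult.commute] z)
  ultimately have e: "conj_transpose ?R ** ?R = - conj_transpose ?R - ?R"
    by (simp add: vec_eq_iff algebra_simps)
  show ?thesis unfolding unitary_def conj_transpose_add
    by (simp add: matrix_add_ldistrib matrix_matrix_add_rdistrib e)
qed

lemma continuous_trace_mul: "continuous_on S (\<lambda>U. Re (trace (U ** (A::complex^'n::finite^'n))))"
  unfolding trace_def matrix_matrix_mult_def by (simp, intro continuous_intros)

lemma nuclear_norm_attained:
  obtains U where "unitary U" "Re (trace (U ** A)) = nuclear_norm A"
    "\<And>V. unitary V \<Longrightarrow> Re (trace (V ** A)) \<le> nuclear_norm A"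
proof -
  obtain U where U: "U \<in> {U. unitary U}" "\<forall>V\<in>{U. unitary U}. Re (trace (V ** A)) \<le> Re (trace (U ** A))"
    using continuous_attains_sup[OF compact_unitary _ continuous_trace_mul, of A] unitary_mat_1 by blast
  have "nuclear_norm A = Re (trace (U ** A))"
    unfolding nuclear_norm_def using U by (intro cSup_eq_maximum) auto
  then show thesis using U that by auto
qed

lemma trace_le_nuclear_norm: "unitary V \<Longrightarrow> Re (trace (V ** A)) \<le> nuclear_norm A"
  by (metis nuclear_norm_attained)

text \<open>Scaling extends the hypothesis to all vectors, and polarization shows that a matrix with
  real quadratic form is Hermitian.\<close>

lemma psdI:
  assumes "\<And>v. norm v = 1 \<Longrightarrow> cinner v (P *v v) \<in> \<real> \<and> 0 \<le> Re (cinner v (P *v v))"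
  shows "psd P"
proof -
  have a: "cinner v (P *v v) \<in> \<real> \<and> 0 \<le> Re (cinner v (P *v v))" for v
  proof (cases "v = 0")
    case True
    then show ?thesis by (simp add: cinner_def)
  next
    case False
    define u where "u = (1 / norm v) *\<^sub>R v"
    have u: "norm u = 1" using False by (simp add: u_def)
    have v: "v = complex_of_real (norm v) *s u"
      using False by (simp add: u_def vec_eq_iff scaleR_conv_of_real[where 'a=complex])
    have "cinner (c *s u) (P *v (c *s u)) = cnj c * c * cinner u (P *v u)" for c
      by (simp add: vector_scalar_commute cinner_scale_left cinner_scale_right)
    from this[of "complex_of_real (norm v)", folded v]
    have "cinner v (P *v v) = complex_of_real ((norm v)\<^sup>2) * cinner u (P *v u)"
      by (simp add: power2_eq_square)
    then show ?thesis using assms[OF u] by (auto intro!: Reals_mult)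
  qed
  have im: "Im (cinner v (P *v v)) = 0" for v using a[of v] by (simp add: complex_is_Real_iff)
  have "cnj (P $ j $ i) = P $ i $ j" for i j
  proof -
    let ?x = "axis i 1 :: complex^'a" and ?y = "axis j 1 :: complex^'a"
    have c: "cinner ?x (P *v ?y) = P $ i $ j" "cinner ?y (P *v ?x) = P $ j $ i"
      by (simp_all add: cinner_axis matrix_vector_mul_axis)
    \<comment> \<open>The form at \<open>?x + ?y\<close> compares the imaginary parts of the two
      off-diagonal entries, the form at \<open>?x + \<i> *s ?y\<close> their real parts.\<close>
    have "Im (cinner (?x + ?y) (P *v (?x + ?y))) = Im (P $ i $ j) + Im (P $ j $ i)"
      by (simp add: matrix_vector_right_distrib cinner_add_left cinner_add_right c im)
    moreover have "Im (cinner (?x + \<i> *s ?y) (P *v (?x + \<i> *s ?y))) = Re (P $ i $ j) - Re (P $ j $ i)"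
      by (simp add: matrix_vector_right_distrib vector_scalar_commute cinner_add_left
          cinner_add_right cinner_scale_left cinner_scale_right c im)
    ultimately show ?thesis using im by (simp add: complex_eq_iff)
  qed
  then show ?thesis using a by (simp add: psd_def vec_eq_iff)
qed

text \<open>Perturbing the maximizer \<open>U\<close> by the unitaries \<open>1 + (z - 1) v v\<^sup>*\<close> with \<open>\<bar>z\<bar> = 1\<close> shows that
  the quadratic form of \<open>U ** A\<close> is real and nonnegative.\<close>

lemma polar_decomposition:
  obtains U where "unitary U" "psd (U ** A)" "Re (trace (U ** A)) = nuclear_norm A"
proof -
  obtain U where U: "unitary U" "Re (trace (U ** A)) = nuclear_norm A"
    "\<And>V. unitary V \<Longrightarrow> Re (trace (V ** A)) \<le> nuclear_norm A"
    using nuclear_norm_attained by blast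
  let ?P = "U ** A"
  have "psd ?P"
  proof (rule psdI)
    fix v :: "complex^'a" assume v: "norm v = 1"
    define w where "w = cinner v (?P *v v)"
    \<comment> \<open>The phase that rotates \<open>w\<close> onto its modulus; maximality of
      \<open>U\<close> then gives \<open>norm w \<le> Re w\<close>, so \<open>w\<close> is real and
      nonnegative. For \<open>w = 0\<close> the value 1 keeps the modulus condition.\<close>
    define z where "z = (if w = 0 then 1 else cnj w / of_real (norm w))"
    have z: "norm z = 1" by (simp add: z_def norm_divide)
    have zw: "z * w = of_real (norm w)"
    proof (cases "w = 0")
      case False
      have "cnj w * w = of_real (norm w) * of_real (norm w)"
        using complex_norm_square[of w] by (simp add: power2_eq_square mult.commute)
      then show ?thesis using False by (simp add: z_def)
    qed (simp add: z_def)
    let ?R = "\<chi> i j. (z - 1) * (v $ i * cnj (v $ j))"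
    have t: "trace (?R ** ?P) = (z - 1) * w"
      unfolding w_def trace_def matrix_matrix_mult_def[of _ ?P] cinner_def matrix_vector_mult_def
      by (simp add: sum_distrib_left sum_distrib_right mult_ac) (rule sum.swap)
    have "Re (trace ((mat 1 + ?R) ** ?P)) \<le> Re (trace ?P)"
      using U(3)[OF unitary_mul[OF unitary_rank_one[OF v z] U(1)]] U(2) by (simp add: matrix_mul_assoc)
    then have "Re (z * w) \<le> Re w"
      unfolding matrix_matrix_add_rdistrib trace_add matrix_mul_lid t by (simp add: left_diff_distrib)
    then have "norm w \<le> Re w" by (simp add: zw)
    then have "Re w = norm w" using complex_Re_le_cmod[of w] by linarith
    then have "Im w = 0" "0 \<le> Re w" using cmod_power2[of w] by auto
    then show "cinner v (?P *v v) \<in> \<real> \<and> 0 \<le> Re (cinner v (?P *v v))"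
      by (simp add: w_def complex_is_Real_iff)
  qed
  then show thesis using U that by blast
qed

section \<open>Positive semidefinite matrices and the trace norm of a partial transpose\<close>

lemma psd_nonneg: "psd A \<Longrightarrow> 0 \<le> Re (cinner x (A *v x))"
  by (simp add: psd_def)

lemma psd_hermitian: "psd A \<Longrightarrow> conj_transpose A = A"
  by (simp add: psd_def)

text \<open>The form may be degenerate: its nonnegativity on a line through \<open>x\<close> in
  direction \<open>y\<close> is a quadratic inequality in \<open>t\<close>, treated separately when
  the form vanishes at \<open>y\<close>.\<close>

lemma psd_cauchy_schwarz:
  assumes "psd A"
  shows "(norm (cinner y (A *v x)))\<^sup>2 \<le> Re (cinner y (A *v y)) * Re (cinner x (A *v x))"
proof -
  define h where "h = cinner y (A *v x)"
  define a where "a = Re (cinner x (A *v x))"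
  define b where "b = Re (cinner y (A *v y))"
  have h': "cinner x (A *v y) = cnj h"
    unfolding h_def by (metis assms cinner_adjoint cinner_commute psd_hermitian)
  have b0: "0 \<le> b" and a0: "0 \<le> a" unfolding a_def b_def using assms by (simp_all add: psd_nonneg)
  have hh: "Re (cnj h * h) = (norm h)\<^sup>2" by (metis Re_complex_of_real complex_norm_square mult.commute)
  have q: "0 \<le> a - 2 * t * (norm h)\<^sup>2 + t\<^sup>2 * (norm h)\<^sup>2 * b" for t :: real
  proof -
    \<comment> \<open>The factor \<open>h\<close> makes both cross terms real and negative for
      positive \<open>t\<close>, with sum \<open>- 2 * t * (norm h)\<^sup>2\<close>.\<close>
    let ?s = "complex_of_real (- t) * h"
    have "cinner (x + s *s y) (A *v (x + s *s y))
        = cinner x (A *v x) + (s * cnj h + cnj s * h) + cnj s * s * cinner y (A *v y)" for s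
      by (simp add: matrix_vector_right_distrib vector_scalar_commute cinner_add_left
          cinner_add_right cinner_scale_left cinner_scale_right h' algebra_simps flip: h_def)
    from this[of ?s] have "cinner (x + ?s *s y) (A *v (x + ?s *s y)) = cinner x (A *v x)
        + complex_of_real (- 2 * t) * (cnj h * h)
        + complex_of_real (t\<^sup>2) * ((cnj h * h) * cinner y (A *v y))"
      by (simp add: algebra_simps power2_eq_square)
    moreover have "cnj h * h = complex_of_real ((norm h)\<^sup>2)"
      by (metis complex_norm_square mult.commute)
    ultimately have "Re (cinner (x + ?s *s y) (A *v (x + ?s *s y)))
        = a - 2 * t * (norm h)\<^sup>2 + t\<^sup>2 * (norm h)\<^sup>2 * b"
      by (simp add: a_def b_def)
    then show ?thesis using assms by (metis psd_nonneg)
  qed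
  show ?thesis
  proof (cases "b = 0")
    case True
    have "norm h = 0"
    proof (rule ccontr)
      assume n: "norm h \<noteq> 0"
      \<comment> \<open>For \<open>b = 0\<close> the bound is affine in \<open>t\<close>; this
        choice of \<open>t\<close> brings it down to -1.\<close>
      have "0 \<le> a - 2 * ((a + 1) / (2 * (norm h)\<^sup>2)) * (norm h)\<^sup>2"
        using q[of "(a + 1) / (2 * (norm h)\<^sup>2)"] True by simp
      then show False using n by simp
    qed
    then show ?thesis using b0 a0 unfolding h_def[symmetric] a_def[symmetric] b_def[symmetric]
      by simp
  next
    case False
    then have b: "0 < b" using b0 by simp
    \<comment> \<open>The value \<open>1 / b\<close> minimizes the quadratic in
      \<open>t\<close>.\<close>
    have "0 \<le> a - (norm h)\<^sup>2 / b" using q[of "1 / b"] b by (simp add: power2_eq_square)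
    then show ?thesis using b unfolding h_def[symmetric] a_def[symmetric] b_def[symmetric]
      by (simp add: pos_divide_le_eq mult.commute)
  qed
qed

text \<open>Cauchy-Schwarz with \<open>y = A *v x\<close> bounds the norm of \<open>A *v x\<close>
  by the vanishing form at \<open>x\<close>.\<close>

lemma psd_null_vector:
  assumes "psd A" "Re (cinner x (A *v x)) = 0"
  shows "A *v x = 0"
proof -
  have "norm (cinner (A *v x) (A *v x)) = 0"
    using psd_cauchy_schwarz[OF assms(1), of "A *v x" x] assms(2) by simp
  then show ?thesis by (simp add: cinner_self)
qed

lemma psd_zero: "psd 0"
  by (simp add: psd_def vec_eq_iff cinner_def)

lemma psd_add: "psd A \<Longrightarrow> psd B \<Longrightarrow> psd (A + B)"
  by (simp add: psd_def conj_transpose_add matrix_vector_mult_add_rdistrib cinner_add_right)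

lemma psd_congruence: "psd P \<Longrightarrow> psd (conj_transpose U ** P ** U)"
proof -
  assume P: "psd P"
  have "cinner x ((conj_transpose U ** P ** U) *v x) = cinner (U *v x) (P *v (U *v x))" for x
    by (metis cinner_adjoint conj_transpose_conj_transpose matrix_vector_mul_assoc)
  then show ?thesis
    using P by (simp add: psd_def conj_transpose_mul matrix_mul_assoc)
qed

text \<open>Cholesky elimination: subtracting a rank-one matrix clears a pivot and keeps the matrix
  positive semidefinite. The number of nonzero diagonal entries decreases, and when none is left
  Cauchy-Schwarz makes the whole matrix zero.\<close>

lemma psd_rank_one_induct [consumes 1, case_names zero add]:
  assumes "psd A" and zero: "Q 0" and add: "\<And>v A. Q A \<Longrightarrow> Q (ket_bra v + A)"
  shows "Q A"
  using assms(1)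
proof (induction "card {i. A $ i $ i \<noteq> 0}" arbitrary: A rule: less_induct)
  case less
  have c: "cinner (axis i 1) (A *v axis j 1) = A $ i $ j" for i j
    by (simp add: cinner_axis matrix_vector_mul_axis)
  have null: "A $ i $ j = 0 \<and> A $ j $ i = 0" if "A $ i $ i = 0" for i j
  proof -
    have "(norm (A $ i $ j))\<^sup>2 \<le> 0"
      using psd_cauchy_schwarz[OF less.prems, of "axis i 1" "axis j 1"] that by (simp only: c) simp
    then have "A $ i $ j = 0" by simp
    moreover have "A $ j $ i = cnj (A $ i $ j)"
      using psd_hermitian[OF less.prems] by (metis conj_transpose_nth)
    ultimately show ?thesis by simp
  qed
  show ?case
  proof (cases "\<forall>i. A $ i $ i = 0")
    case True
    then have "A $ i $ j = 0" for i j using null by blast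
    then have "A = 0" by (simp add: vec_eq_iff)
    then show ?thesis using zero by simp
  next
    case False
    then obtain i where i: "A $ i $ i \<noteq> 0" by blast
    define a where "a = Re (A $ i $ i)"
    have "0 \<le> a" using psd_nonneg[OF less.prems, of "axis i 1"] by (simp add: c a_def)
    have herm: "cnj (A $ k $ l) = A $ l $ k" for k l
      using psd_hermitian[OF less.prems] by (metis conj_transpose_nth)
    have Aii: "A $ i $ i = of_real a"
      using herm[of i i] by (simp add: a_def complex_eq_iff)
    then have a: "0 < a" using i \<open>0 \<le> a\<close> by (cases "a = 0") auto
    \<comment> \<open>The pivot column divided by the root of the pivot; Cauchy-Schwarz against
      \<open>axis i 1\<close> is exactly what keeps the remainder positive.\<close>
    define u where "u = complex_of_real (1 / sqrt a) *s (A *v axis i 1)"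
    have u: "u $ k = A $ k $ i / of_real (sqrt a)" for k
      by (simp add: u_def matrix_vector_mul_axis)
    have ux: "cinner u x = cinner (axis i 1) (A *v x) / of_real (sqrt a)" for x
      by (simp add: u_def cinner_scale_left cinner_adjoint psd_hermitian[OF less.prems])
    have s: "complex_of_real (sqrt a) * complex_of_real (sqrt a) = of_real a"
      using a by (simp flip: of_real_mult)
    define B where "B = A - ket_bra u"
    have AB: "A = ket_bra u + B" by (simp add: B_def)
    have "psd B" unfolding psd_def
    proof (intro conjI allI)
      show "conj_transpose B = B"
        by (simp add: B_def vec_eq_iff herm mult.commute)
      fix x
      have "Re (cinner x (ket_bra u *v x)) = (norm (cinner u x))\<^sup>2" by (simp add: cinner_ket_bra)
      also have "\<dots> = (norm (cinner (axis i 1) (A *v x)))\<^sup>2 / a"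
        using a by (simp add: ux norm_divide power_divide)
      also have "\<dots> \<le> Re (cinner x (A *v x))"
        using psd_cauchy_schwarz[OF less.prems, of "axis i 1" x] a
        by (simp add: c a_def[symmetric] pos_divide_le_eq mult.commute)
      finally show "0 \<le> Re (cinner x (B *v x))"
        by (simp add: B_def matrix_vector_mult_diff_rdistrib cinner_diff_right)
    qed
    \<comment> \<open>The pivot entry becomes zero, and a zero diagonal entry stays zero because its
      whole row vanishes, hence also that entry of \<open>u\<close>.\<close>
    moreover have "{k. B $ k $ k \<noteq> 0} \<subset> {k. A $ k $ k \<noteq> 0}"
    proof -
      have "B $ i $ i = 0" using a by (simp add: B_def u Aii s)
      moreover have "B $ k $ k = 0" if "A $ k $ k = 0" for k
        using null[OF that, of i] that by (simp add: B_def u)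
      ultimately show ?thesis using i by blast
    qed
    ultimately have "Q B" using less.hyps by (simp add: psubset_card_mono)
    then show ?thesis using add AB by metis
  qed
qed

section \<open>Kronecker products of positive semidefinite matrices\<close>

definition kron ::
    "complex^'a::finite^'a \<Rightarrow> complex^'b::finite^'b \<Rightarrow> complex^('a \<times> 'b)^('a \<times> 'b)" where
  "kron X Y = (\<chi> r s. X $ fst r $ fst s * Y $ snd r $ snd s)"

lemma kron_nth [simp]: "kron X Y $ r $ s = X $ fst r $ fst s * Y $ snd r $ snd s"
  by (simp add: kron_def)

lemma sum_UNIV_prod: "(\<Sum>r\<in>UNIV. f r) = (\<Sum>i\<in>UNIV. \<Sum>j\<in>UNIV. f (i, j))"
  by (simp add: sum.cartesian_product flip: UNIV_Times_UNIV)

lemma kron_mul: "kron X Y ** kron X' Y' = kron (X ** X') (Y ** Y')"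
  by (simp add: vec_eq_iff matrix_matrix_mult_def sum_UNIV_prod sum_product mult_ac)

lemma trace_kron: "trace (kron X Y) = trace X * trace Y"
  by (simp add: trace_def sum_UNIV_prod sum_product)

text \<open>The product is additive in \<open>X\<close>, so rank-one induction leaves only
  \<open>X = ket_bra v\<close>.\<close>

lemma psd_kron:
  fixes X :: "complex^'a::finite^'a" and Y :: "complex^'b::finite^'b"
  assumes "psd X" "psd Y"
  shows "psd (kron X Y)"
  using assms(1)
proof (induction X rule: psd_rank_one_induct)
  case zero
  have "kron (0::complex^'a^'a) Y = 0" by (simp add: vec_eq_iff)
  then show ?case by (simp add: psd_zero)
next
  case (add v X)
  have h: "cnj (Y $ k $ l) = Y $ l $ k" for k l
    using psd_hermitian[OF assms(2)] by (metis conj_transpose_nth)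
  have "psd (kron (ket_bra v) Y)" unfolding psd_def
  proof (intro conjI allI)
    show "conj_transpose (kron (ket_bra v) Y) = kron (ket_bra v) Y"
      by (simp add: vec_eq_iff h mult_ac)
    fix x :: "complex^('a \<times> 'b)"
    \<comment> \<open>Contracting the first factor of \<open>x\<close> with the conjugate of
      \<open>v\<close> turns the form of the product into the form of \<open>Y\<close> at
      \<open>y\<close>.\<close>
    define y where "y = (\<chi> j. \<Sum>i\<in>UNIV. cnj (v $ i) * x $ (i, j))"
    have "cinner x (kron (ket_bra v) Y *v x) = (\<Sum>i\<in>UNIV. \<Sum>j\<in>UNIV. \<Sum>k\<in>UNIV. \<Sum>l\<in>UNIV.
        cnj (x $ (i, j)) * v $ i * cnj (v $ k) * Y $ j $ l * x $ (k, l))"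
      by (simp add: cinner_def matrix_vector_mult_def sum_UNIV_prod sum_distrib_left mult_ac)
    also have "\<dots> = (\<Sum>j\<in>UNIV. \<Sum>i\<in>UNIV. \<Sum>l\<in>UNIV. \<Sum>k\<in>UNIV.
        cnj (x $ (i, j)) * v $ i * cnj (v $ k) * Y $ j $ l * x $ (k, l))"
      by (subst sum.swap, rule sum.cong[OF refl], rule sum.cong[OF refl], rule sum.swap)
    also have "\<dots> = (\<Sum>j\<in>UNIV. \<Sum>l\<in>UNIV. \<Sum>i\<in>UNIV. \<Sum>k\<in>UNIV.
        cnj (x $ (i, j)) * v $ i * cnj (v $ k) * Y $ j $ l * x $ (k, l))"
      by (rule sum.cong[OF refl], rule sum.swap)
    also have "\<dots> = (\<Sum>j\<in>UNIV. \<Sum>l\<in>UNIV. \<Sum>k\<in>UNIV. \<Sum>i\<in>UNIV.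
        cnj (x $ (i, j)) * v $ i * cnj (v $ k) * Y $ j $ l * x $ (k, l))"
      by (rule sum.cong[OF refl], rule sum.cong[OF refl], rule sum.swap)
    also have "\<dots> = cinner y (Y *v y)"
      unfolding cinner_def y_def matrix_vector_mult_def
      by (simp add: sum_distrib_left sum_distrib_right mult_ac)
    finally show "0 \<le> Re (cinner x (kron (ket_bra v) Y *v x))"
      using assms(2) by (simp add: psd_nonneg)
  qed
  moreover have "kron (ket_bra v + X) Y = kron (ket_bra v) Y + kron X Y"
    by (simp add: vec_eq_iff algebra_simps)
  ultimately show ?case using add psd_add by metis
qed

section \<open>Uniqueness of the positive semidefinite square root\<close>

lemma conj_transpose_mul_self_eq_0:
  assumes "conj_transpose D ** D = 0"
  shows "D = 0"
proof -
  have "D *v x = 0" for x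
  proof -
    have "cinner (D *v x) (D *v x) = cinner x ((conj_transpose D ** D) *v x)"
      by (simp add: cinner_adjoint flip: matrix_vector_mul_assoc)
    also have "\<dots> = 0" by (simp add: assms cinner_def)
    finally show ?thesis by (simp add: cinner_self)
  qed
  then have "(D *v axis j 1) $ i = 0" for i j by simp
  then show ?thesis by (simp add: vec_eq_iff matrix_vector_mul_axis)
qed

text \<open>The vectors \<open>D *v axis i 1\<close> are the columns of \<open>D\<close>, so for
  positive \<open>P\<close> the trace is a sum of nonnegative terms.\<close>

lemma trace_congruence:
  "Re (trace (conj_transpose D ** P ** D))
    = (\<Sum>i\<in>UNIV. Re (cinner (D *v axis i 1) (P *v (D *v axis i 1))))"
proof -
  have "(conj_transpose D ** P ** D) $ i $ i = cinner (D *v axis i 1) (P *v (D *v axis i 1))" for i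
    by (simp add: cinner_axis cinner_adjoint[of "axis i 1" "conj_transpose D", simplified, symmetric]
       flip: matrix_vector_mul_axis matrix_vector_mul_assoc)
  then show ?thesis by (simp add: trace_def)
qed

text \<open>With \<open>D = P - Q\<close> one has \<open>P ** D + D ** Q = 0\<close>; multiplying by \<open>D\<close> and taking the trace
  gives a vanishing sum of traces of positive semidefinite matrices.\<close>

lemma psd_square_unique:
  assumes P: "psd P" and Q: "psd Q" and PQ: "P ** P = Q ** Q"
  shows "P = Q"
proof -
  define D where "D = P - Q"
  have dl: "X ** (Y - Z) = X ** Y - X ** Z" and dr: "(Y - Z) ** X = Y ** X - Z ** X"
    for X Y Z :: "complex^'a^'a"
    by (simp_all add: vec_eq_iff matrix_matrix_mult_def algebra_simps sum_subtractf)
  have hD: "conj_transpose D = D"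
    by (simp add: D_def conj_transpose_diff psd_hermitian P Q)
  have PD: "P ** D + D ** Q = 0" by (simp add: D_def dl dr PQ)
  have "trace (D ** P ** D) + trace (D ** Q ** D) = trace (D ** (P ** D + D ** Q))"
    by (simp add: matrix_add_ldistrib trace_add matrix_mul_assoc)
       (metis trace_mul_sym matrix_mul_assoc)
  also have "\<dots> = 0" unfolding PD by (simp add: trace_def matrix_matrix_mult_def)
  finally have "Re (trace (D ** P ** D)) + Re (trace (D ** Q ** D)) = 0"
    by (metis plus_complex.sel(1) zero_complex.sel(1))
  then have "(\<Sum>i\<in>UNIV. Re (cinner (D *v axis i 1) (P *v (D *v axis i 1)))
      + Re (cinner (D *v axis i 1) (Q *v (D *v axis i 1)))) = 0"
    using trace_congruence[of D P] trace_congruence[of D Q] by (simp add: hD sum.distrib)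
  then have z: "Re (cinner (D *v axis i 1) (P *v (D *v axis i 1)))
      + Re (cinner (D *v axis i 1) (Q *v (D *v axis i 1))) = 0" for i
    using psd_nonneg[OF P] psd_nonneg[OF Q]
    by (subst (asm) sum_nonneg_eq_0_iff) auto
  \<comment> \<open>Two nonnegative numbers with sum zero both vanish, so \<open>P\<close> and
    \<open>Q\<close>, and therefore \<open>D\<close>, annihilate the columns of
    \<open>D\<close>.\<close>
  have "P *v (D *v axis i 1) = 0" "Q *v (D *v axis i 1) = 0" for i
    using z[of i] psd_nonneg[OF P, of "D *v axis i 1"] psd_nonneg[OF Q, of "D *v axis i 1"]
    by (auto intro!: psd_null_vector P Q)
  then have "D *v (D *v axis i 1) = 0" for i
    by (simp add: D_def matrix_vector_mult_diff_rdistrib)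
  then have "((D ** D) *v axis j 1) $ i = 0" for i j
    by (simp flip: matrix_vector_mul_assoc)
  then have "D ** D = 0" by (simp add: vec_eq_iff matrix_vector_mul_axis)
  then have "D = 0" using conj_transpose_mul_self_eq_0[of D] hD by simp
  then show ?thesis by (simp add: D_def)
qed

lemma psd_sqrt_eqI: "psd P \<Longrightarrow> P ** P = A \<Longrightarrow> psd_sqrt A = P"
  unfolding psd_sqrt_def by (rule the_equality) (auto intro: psd_square_unique)

section \<open>Pure states as matrices and the trace norm of their partial transposes\<close>

definition mat_of :: "complex^('a::finite \<times> 'b::finite) \<Rightarrow> complex^'b^'a" where
  "mat_of v = (\<chi> i j. v $ (i, j))"

lemma mat_of_nth [simp]: "mat_of v $ i $ j = v $ (i, j)"
  by (simp add: mat_of_def)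

text \<open>With the polar form of \<open>?A\<close>, the absolute value of the partial transpose is
  \<open>kron R P\<close>, where \<open>R\<close> is unitarily conjugate to \<open>P\<close>; its
  trace is the square of the trace of \<open>P\<close>.\<close>

lemma trace_norm_partial_transpose_pure:
  fixes v :: "complex^('n::finite \<times> 'n)"
  shows "trace_norm (partial_transpose (ket_bra v)) = (nuclear_norm (mat_of v))\<^sup>2"
proof -
  let ?A = "mat_of v"
  let ?M = "partial_transpose (ket_bra v)"
  obtain U where U: "unitary U" "psd (U ** ?A)" "Re (trace (U ** ?A)) = nuclear_norm ?A"
    using polar_decomposition by blast
  define P where "P = U ** ?A"
  have P: "psd P" "conj_transpose P = P" using U(2) by (simp_all add: P_def psd_hermitian)
  define R where "R = conj_transpose U ** P ** U"
  \<comment> \<open>The partial transpose swaps the column indices of the two factors, so the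
    product decouples into the two Gram matrices of \<open>?A\<close>.\<close>
  have "conj_transpose ?M ** ?M = kron (?A ** conj_transpose ?A) (conj_transpose ?A ** ?A)"
    by (simp add: vec_eq_iff matrix_matrix_mult_def partial_transpose_def sum_UNIV_prod sum_product)
       (subst sum.swap, simp add: mult_ac)
  also have "?A = conj_transpose U ** P"
    using U(1) by (simp add: P_def unitary_def matrix_mul_assoc)
  also have "kron (conj_transpose U ** P ** conj_transpose (conj_transpose U ** P))
      (conj_transpose (conj_transpose U ** P) ** (conj_transpose U ** P)) = kron (R ** R) (P ** P)"
    using unitary_right[OF U(1)]
    by (simp add: R_def conj_transpose_mul P(2)) (metis matrix_mul_assoc matrix_mul_rid)
  finally have "psd_sqrt (conj_transpose ?M ** ?M) = kron R P"
    by (intro psd_sqrt_eqI psd_kron P(1)) (simp_all add: R_def psd_congruence P(1) kron_mul)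
  moreover have "trace R = trace P"
    using unitary_right[OF U(1)] unfolding R_def
    by (subst trace_mul_sym) (simp add: matrix_mul_assoc)
  \<comment> \<open>A real trace makes the real part of its square the square of its real
    part.\<close>
  moreover have "Im (trace P) = 0"
    using trace_conj_transpose[of P] P(2) by (simp add: complex_eq_iff)
  ultimately show ?thesis
    by (simp add: trace_norm_def trace_kron power2_eq_square U(3)[folded P_def])
qed

section \<open>Averages over pure-state decompositions\<close>

lemma nuclear_norm_leI:
  "(\<And>V. unitary V \<Longrightarrow> Re (trace (V ** A)) \<le> b) \<Longrightarrow> nuclear_norm A \<le> b"
  by (metis nuclear_norm_attained)

lemma nuclear_norm_unitary_left:
  assumes "unitary U" shows "nuclear_norm (U ** A) = nuclear_norm A"
proof -
  have le: "nuclear_norm (W ** B) \<le> nuclear_norm B" if "unitary W" for W B :: "complex^'a^'a"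
    by (rule nuclear_norm_leI) (simp add: matrix_mul_assoc trace_le_nuclear_norm unitary_mul that)
  have "conj_transpose U ** (U ** A) = A"
    using assms by (simp add: matrix_mul_assoc unitary_def)
  then show ?thesis
    using le[OF assms, of A] le[OF unitary_conj_transpose[OF assms], of "U ** A"] by simp
qed

lemma nuclear_norm_unitary_right:
  assumes "unitary U" shows "nuclear_norm (A ** U) = nuclear_norm A"
proof -
  have le: "nuclear_norm (B ** W) \<le> nuclear_norm B" if W: "unitary W" for W B :: "complex^'a^'a"
  proof (rule nuclear_norm_leI)
    fix V :: "complex^'a^'a" assume "unitary V"
    then have "Re (trace ((W ** V) ** B)) \<le> nuclear_norm B"
      by (intro trace_le_nuclear_norm unitary_mul W)
    then show "Re (trace (V ** (B ** W))) \<le> nuclear_norm B"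
      by (metis matrix_mul_assoc trace_mul_sym)
  qed
  have "(A ** U) ** conj_transpose U = A"
    using unitary_right[OF assms] by (simp flip: matrix_mul_assoc)
  then show ?thesis
    using le[OF assms, of A] le[OF unitary_conj_transpose[OF assms], of "A ** U"] by simp
qed

lemma nuclear_norm_transpose: "nuclear_norm (transpose A) = nuclear_norm A"
proof -
  have tr: "trace (transpose B) = trace B" for B :: "complex^'a^'a"
    by (simp add: trace_def transpose_def)
  have le: "nuclear_norm (transpose B) \<le> nuclear_norm B" for B :: "complex^'a^'a"
  proof (rule nuclear_norm_leI)
    fix V :: "complex^'a^'a" assume "unitary V"
    then have "Re (trace (transpose V ** B)) \<le> nuclear_norm B"
      by (intro trace_le_nuclear_norm unitary_transpose)
    then show "Re (trace (V ** transpose B)) \<le> nuclear_norm B"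
      by (metis tr matrix_transpose_mul transpose_transpose trace_mul_sym)
  qed
  show ?thesis using le[of A] le[of "transpose A"] by simp
qed

lemma matrix_mul_scaleR_right: "A ** (c *\<^sub>R B) = c *\<^sub>R (A ** (B::complex^'n::finite^'m::finite))"
  by (simp add: vec_eq_iff matrix_matrix_mult_def scaleR_sum_right)

lemma matrix_mul_scaleR_left: "(c *\<^sub>R A) ** B = c *\<^sub>R ((A::complex^'n::finite^'m::finite) ** B)"
  by (simp add: vec_eq_iff matrix_matrix_mult_def scaleR_sum_right)

lemma trace_scaleR: "trace (c *\<^sub>R A) = c *\<^sub>R trace (A::complex^'n::finite^'n)"
  by (simp add: trace_def scaleR_sum_right)

lemma nuclear_norm_scaleR:
  assumes "0 \<le> c" shows "nuclear_norm (c *\<^sub>R A) = c * nuclear_norm A"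
proof (rule antisym)
  show "nuclear_norm (c *\<^sub>R A) \<le> c * nuclear_norm A"
    by (rule nuclear_norm_leI)
       (simp add: matrix_mul_scaleR_right trace_scaleR mult_left_mono assms trace_le_nuclear_norm)
  obtain U where "unitary U" "Re (trace (U ** A)) = nuclear_norm A"
    using nuclear_norm_attained by blast
  then show "c * nuclear_norm A \<le> nuclear_norm (c *\<^sub>R A)"
    using trace_le_nuclear_norm[of U "c *\<^sub>R A"] by (simp add: matrix_mul_scaleR_right trace_scaleR)
qed

lemma nuclear_norm_add: "nuclear_norm (A + B) \<le> nuclear_norm A + nuclear_norm B"
  by (rule nuclear_norm_leI)
     (simp add: matrix_add_ldistrib trace_add add_mono trace_le_nuclear_norm)

text \<open>Subadditivity and homogeneity give convexity, and a real convex function on a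
  finite-dimensional space is continuous.\<close>

lemma continuous_nuclear_norm: "continuous_on UNIV nuclear_norm"
proof (intro convex_on_continuous convex_onI open_UNIV convex_UNIV)
  fix t :: real and A B :: "complex^'a^'a"
  assume "0 < t" "t < 1"
  then show "nuclear_norm ((1 - t) *\<^sub>R A + t *\<^sub>R B) \<le> (1 - t) * nuclear_norm A + t * nuclear_norm B"
    using nuclear_norm_add[of "(1 - t) *\<^sub>R A" "t *\<^sub>R B"] by (simp add: nuclear_norm_scaleR)
qed

section \<open>Ensemble averages as points of a compact convex hull\<close>

lemma negativity_pure:
  fixes v :: "complex^('n::finite \<times> 'n)"
  shows "negativity (ket_bra v) = ((nuclear_norm (mat_of v))\<^sup>2 - 1) / (real CARD('n) - 1)"
  by (simp add: negativity_def trace_norm_partial_transpose_pure)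

lemma continuous_negativity_pure:
  "continuous_on UNIV (\<lambda>v::complex^('n::finite \<times> 'n). negativity (ket_bra v))"
proof -
  have "continuous_on UNIV (\<lambda>v::complex^('n \<times> 'n). mat_of v)"
    unfolding mat_of_def by (intro continuous_intros)
  then have "continuous_on UNIV (\<lambda>v::complex^('n \<times> 'n). nuclear_norm (mat_of v))"
    by (rule continuous_on_compose2[OF continuous_nuclear_norm]) auto
  then show ?thesis unfolding negativity_pure divide_inverse by (intro continuous_intros)
qed

text \<open>Keeping state and negativity together lets a single convex combination record both the
  mixed state and its average.\<close>

definition pure_negativity_pairs ::
    "((complex^('n::finite \<times> 'n)^('n \<times> 'n)) \<times> real) set" where
  "pure_negativity_pairs = (\<lambda>v. (ket_bra v, negativity (ket_bra v))) ` {v. norm v = 1}"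

lemma compact_pure_negativity_pairs: "compact pure_negativity_pairs"
  unfolding pure_negativity_pairs_def
proof (rule compact_continuous_image)
  have "continuous_on UNIV (\<lambda>v::complex^('a \<times> 'a). ket_bra v)"
    unfolding ket_bra_def by (intro continuous_intros)
  then show "continuous_on {v. norm v = 1}
      (\<lambda>v::complex^('a \<times> 'a). (ket_bra v, negativity (ket_bra v)))"
    by (intro continuous_on_Pair) (auto intro: continuous_on_subset continuous_negativity_pure)
  show "compact {v::complex^('a \<times> 'a). norm v = 1}"
    using compact_sphere[of 0 1] by (simp add: sphere_def)
qed

text \<open>Convex hulls of compact sets in finite dimension are compact, so this description makes
  the maximum in the definition of \<^const>\<open>noa\<close> attained.\<close>

lemma average_negativities_convex_hull:
  "average_negativities \<rho> = {t. (\<rho>, t) \<in> convex hull pure_negativity_pairs}"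
proof (intro set_eqI iffI)
  fix t assume "t \<in> average_negativities \<rho>"
  then obtain K p \<psi> where t: "t = (\<Sum>k<K. p k * negativity (ket_bra (\<psi> k)))"
    and d: "pure_decomposition \<rho> K p \<psi>"
    unfolding average_negativities_def by blast
  have "(\<Sum>k<K. p k *\<^sub>R (ket_bra (\<psi> k), negativity (ket_bra (\<psi> k))))
      \<in> convex hull pure_negativity_pairs"
    using d by (intro convex_sum hull_inc convex_convex_hull)
       (auto simp: pure_decomposition_def pure_negativity_pairs_def)
  moreover have "(\<Sum>k<K. p k *\<^sub>R (ket_bra (\<psi> k), negativity (ket_bra (\<psi> k)))) = (\<rho>, t)"
    using d by (simp add: t pure_decomposition_def prod_eq_iff fst_sum snd_sum)
  ultimately show "t \<in> {t. (\<rho>, t) \<in> convex hull pure_negativity_pairs}" by simp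
next
  fix t assume "t \<in> {t. (\<rho>, t) \<in> convex hull pure_negativity_pairs}"
  then obtain k u x where *: "\<forall>i\<in>{1::nat..k}. 0 \<le> u i \<and> x i \<in> pure_negativity_pairs"
    "sum u {1..k} = 1" "(\<Sum>i = 1..k. u i *\<^sub>R x i) = (\<rho>, t)"
    unfolding convex_hull_indexed by auto
  have "\<forall>i\<in>{1..k}. \<exists>v. norm v = 1 \<and> x i = (ket_bra v, negativity (ket_bra v))"
    using *(1) by (auto simp: pure_negativity_pairs_def)
  then obtain \<psi> where \<psi>: "\<And>i. i \<in> {1..k} \<Longrightarrow> norm (\<psi> i) = 1 \<and> x i = (ket_bra (\<psi> i), negativity (ket_bra (\<psi> i)))"
    by metis
  \<comment> \<open>Convex hulls are indexed from 1 to \<open>k\<close>, decompositions from 0 to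
    \<open>k - 1\<close>.\<close>
  have sh: "(\<Sum>i = 1..k. f i) = (\<Sum>i<k. f (Suc i))" for f :: "nat \<Rightarrow> 'z::comm_monoid_add"
    by (simp add: sum.atLeast1_atMost_eq)
  have \<psi>': "norm (\<psi> (Suc i)) = 1 \<and> x (Suc i) = (ket_bra (\<psi> (Suc i)), negativity (ket_bra (\<psi> (Suc i))))"
    if "i < k" for i using \<psi>[of "Suc i"] that by auto
  have "(\<Sum>i<k. u (Suc i) *\<^sub>R (ket_bra (\<psi> (Suc i)), negativity (ket_bra (\<psi> (Suc i))))) = (\<rho>, t)"
    using *(3) unfolding sh by (metis (no_types, lifting) \<psi>' lessThan_iff sum.cong)
  then have \<rho>: "\<rho> = (\<Sum>i<k. u (Suc i) *\<^sub>R ket_bra (\<psi> (Suc i)))"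
    and t: "t = (\<Sum>i<k. u (Suc i) * negativity (ket_bra (\<psi> (Suc i))))"
    by (auto simp: prod_eq_iff fst_sum snd_sum)
  have "pure_decomposition \<rho> k (\<lambda>i. u (Suc i)) (\<lambda>i. \<psi> (Suc i))"
    using *(1,2) \<psi>' \<rho> unfolding sh by (auto simp: pure_decomposition_def)
  with t show "t \<in> average_negativities \<rho>"
    unfolding average_negativities_def mem_Collect_eq by (intro exI conjI)
qed

lemma noa_ge:
  assumes "x \<in> average_negativities \<rho>" shows "x \<le> noa \<rho>"
proof -
  \<comment> \<open>The slice of the hull over \<open>\<rho>\<close> is compact, and its second
    projection is the set of averages; so a greatest average exists.\<close>
  let ?C = "convex hull pure_negativity_pairs \<inter> {p. fst p = \<rho>}"
  have "closed {p::_ \<times> real. fst p = \<rho>}"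
    by (intro closed_Collect_eq continuous_intros)
  then have "compact ?C"
    by (intro compact_Int_closed compact_convex_hull compact_pure_negativity_pairs)
  then have "compact (snd ` ?C)"
    by (rule compact_continuous_image[rotated]) (intro continuous_intros)
  moreover have "snd ` ?C = average_negativities \<rho>"
    by (force simp: average_negativities_convex_hull)
  ultimately have "compact (average_negativities \<rho>)" by simp
  then obtain m where "m \<in> average_negativities \<rho>" "\<And>y. y \<in> average_negativities \<rho> \<Longrightarrow> y \<le> m"
    using compact_attains_sup[of "average_negativities \<rho>"] assms by blast
  moreover from this have "noa \<rho> = m" unfolding noa_def by (intro Greatest_equality)
  ultimately show ?thesis using assms by simp
qed

lemma ket_bra_scaleR: "ket_bra (c *\<^sub>R v) = c\<^sup>2 *\<^sub>R ket_bra v"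
  by (simp add: vec_eq_iff power2_eq_square)

lemma mat_of_scaleR: "mat_of (c *\<^sub>R v) = c *\<^sub>R mat_of v"
  by (simp add: vec_eq_iff)

text \<open>The squared norms serve as probabilities. The squared nuclear norm scales by the same
  factor, so the weights are absorbed.\<close>

lemma ensemble_average_negativity:
  fixes v :: "'k \<Rightarrow> complex^('n::finite \<times> 'n)"
  assumes I: "finite I" and \<rho>: "\<rho> = (\<Sum>k\<in>I. ket_bra (v k))" and n: "(\<Sum>k\<in>I. (norm (v k))\<^sup>2) = 1"
  shows "((\<Sum>k\<in>I. (nuclear_norm (mat_of (v k)))\<^sup>2) - 1) / (real CARD('n) - 1)
    \<in> average_negativities \<rho>"
proof -
  \<comment> \<open>A zero vector has weight zero; an arbitrary unit vector stands in for its
    direction.\<close>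
  define u where "u k = (if v k = 0 then axis undefined 1 else (1 / norm (v k)) *\<^sub>R v k)" for k
  have u: "norm (u k) = 1" for k by (simp add: u_def)
  have v: "v k = norm (v k) *\<^sub>R u k" for k by (simp add: u_def)
  have kb: "(norm (v k))\<^sup>2 *\<^sub>R ket_bra (u k) = ket_bra (v k)" for k
    by (metis v ket_bra_scaleR)
  have "nuclear_norm (mat_of (v k)) = norm (v k) * nuclear_norm (mat_of (u k))" for k
    by (metis v mat_of_scaleR nuclear_norm_scaleR norm_ge_zero)
  then have ng: "(norm (v k))\<^sup>2 * negativity (ket_bra (u k))
      = ((nuclear_norm (mat_of (v k)))\<^sup>2 - (norm (v k))\<^sup>2) / (real CARD('n) - 1)" for k
    by (simp add: negativity_pure power_mult_distrib right_diff_distrib)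
  have "(\<Sum>k\<in>I. (norm (v k))\<^sup>2 *\<^sub>R (ket_bra (u k), negativity (ket_bra (u k))))
      \<in> convex hull pure_negativity_pairs"
    by (intro convex_sum hull_inc convex_convex_hull I n)
       (auto simp: pure_negativity_pairs_def u)
  moreover have "(\<Sum>k\<in>I. (norm (v k))\<^sup>2 *\<^sub>R (ket_bra (u k), negativity (ket_bra (u k))))
      = (\<rho>, ((\<Sum>k\<in>I. (nuclear_norm (mat_of (v k)))\<^sup>2) - 1) / (real CARD('n) - 1))"
    by (simp add: prod_eq_iff fst_sum snd_sum kb ng \<rho> n sum_subtractf flip: sum_divide_distrib)
  ultimately show ?thesis by (simp add: average_negativities_convex_hull)
qed

section \<open>Ensembles of a pure state\<close>

lemma cinner_sum_ket_bra:
  "cinner x ((\<Sum>k\<in>I. p k *\<^sub>R ket_bra (v k)) *v x) = of_real (\<Sum>k\<in>I. p k * (norm (cinner (v k) x))\<^sup>2)"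
proof (induction I rule: infinite_finite_induct)
  case (insert k I)
  have "(p k *\<^sub>R ket_bra (v k)) *v x = complex_of_real (p k) *s (ket_bra (v k) *v x)"
    by (simp add: vec_eq_iff matrix_vector_mult_def sum_distrib_left scaleR_conv_of_real[where 'a=complex] mult_ac)
  with insert show ?case
    by (simp add: matrix_vector_mult_add_rdistrib cinner_add_right cinner_scale_right cinner_ket_bra)
qed (simp_all add: cinner_def)

text \<open>The form of the pure state vanishes on the part \<open>x\<close> of
  \<open>\<psi> k\<close> orthogonal to \<open>\<phi>\<close>. All terms of the ensemble form are
  nonnegative, so \<open>x\<close> is orthogonal to \<open>\<psi> k\<close> and hence zero.\<close>

lemma pure_decomposition_of_pure:
  assumes "norm \<phi> = 1" "pure_decomposition (ket_bra \<phi>) K p \<psi>" "k < K" "p k \<noteq> 0"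
  shows "ket_bra (\<psi> k) = ket_bra \<phi>"
proof -
  have p: "\<And>j. j < K \<Longrightarrow> 0 \<le> p j" and n: "norm (\<psi> k) = 1"
    and e: "ket_bra \<phi> = (\<Sum>j<K. p j *\<^sub>R ket_bra (\<psi> j))"
    using assms unfolding pure_decomposition_def by auto
  define c where "c = cinner \<phi> (\<psi> k)"
  define x where "x = \<psi> k - c *s \<phi>"
  have f: "cinner \<phi> \<phi> = 1" by (simp add: cinner_self assms)
  have o: "cinner \<phi> x = 0"
    by (simp add: x_def cinner_diff_right cinner_scale_right f c_def)
  have "complex_of_real (\<Sum>j<K. p j * (norm (cinner (\<psi> j) x))\<^sup>2) = 0"
    by (subst cinner_sum_ket_bra[symmetric]) (simp add: o cinner_ket_bra flip: e)
  then have "(\<Sum>j<K. p j * (norm (cinner (\<psi> j) x))\<^sup>2) = 0" by (simp only: of_real_eq_0_iff)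
  then have "p k * (norm (cinner (\<psi> k) x))\<^sup>2 = 0"
    using p assms(3) by (subst (asm) sum_nonneg_eq_0_iff) auto
  then have "cinner (\<psi> k) x = 0" using assms(4) by simp
  then have "cinner x (\<psi> k) = 0" by (metis cinner_commute complex_cnj_zero)
  moreover have "cinner x \<phi> = 0" using o by (metis cinner_commute complex_cnj_zero)
  ultimately have "cinner x x = 0"
    by (subst (2) x_def) (simp add: cinner_diff_right cinner_scale_right)
  then have "x = 0" by (simp add: cinner_self)
  then have k: "\<psi> k = c *s \<phi>" by (simp add: x_def)
  have "cinner (\<psi> k) (\<psi> k) = 1" by (simp add: cinner_self n)
  \<comment> \<open>Only a global phase is left, which the projector does not see.\<close>
  then have "c * cnj c = 1" by (simp add: k cinner_scale_left cinner_scale_right f)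
  then show ?thesis by (simp add: vec_eq_iff k)
qed

lemma average_negativities_pure:
  assumes "norm \<phi> = 1"
  shows "average_negativities (ket_bra \<phi>) = {negativity (ket_bra \<phi>)}"
proof (intro set_eqI iffI)
  fix t assume "t \<in> average_negativities (ket_bra \<phi>)"
  then obtain K p \<psi> where t: "t = (\<Sum>k<K. p k * negativity (ket_bra (\<psi> k)))"
    and d: "pure_decomposition (ket_bra \<phi>) K p \<psi>"
    unfolding average_negativities_def by blast
  have "t = (\<Sum>k<K. p k * negativity (ket_bra \<phi>))"
    unfolding t
  proof (rule sum.cong[OF refl])
    fix k assume "k \<in> {..<K}"
    then show "p k * negativity (ket_bra (\<psi> k)) = p k * negativity (ket_bra \<phi>)"
      using pure_decomposition_of_pure[OF assms d, of k] by (cases "p k = 0") auto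
  qed
  also have "\<dots> = negativity (ket_bra \<phi>)"
    using d by (simp add: pure_decomposition_def flip: sum_distrib_right)
  finally show "t \<in> {negativity (ket_bra \<phi>)}" by simp
next
  fix t assume "t \<in> {negativity (ket_bra \<phi>)}"
  then show "t \<in> average_negativities (ket_bra \<phi>)"
    using assms by (auto simp: average_negativities_convex_hull pure_negativity_pairs_def intro!: hull_inc)
qed

lemma cren_pure: "norm \<phi> = 1 \<Longrightarrow> cren (ket_bra \<phi>) = negativity (ket_bra \<phi>)"
  by (auto simp: cren_def average_negativities_pure intro: Least_equality)

section \<open>Measurements in a generalized Bell basis\<close>

text \<open>The vectorized matrices resolve the identity, as an orthonormal basis does.\<close>

definition complete_family :: "'k set \<Rightarrow> ('k \<Rightarrow> complex^'n::finite^'n) \<Rightarrow> bool" where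
  "complete_family I B \<longleftrightarrow> finite I \<and> (\<forall>b d b' d'.
     (\<Sum>k\<in>I. B k $ b $ d * cnj (B k $ b' $ d')) = (if b = b' \<and> d = d' then 1 else 0))"

text \<open>Completeness collapses the sum over \<open>k\<close>. For
  \<open>X = mat_of \<phi>\<close> and \<open>Y = transpose (mat_of \<psi>)\<close> the right-hand
  side is an entry of the reduced state.\<close>

lemma complete_family_sandwich:
  fixes X Y :: "complex^'n::finite^'n"
  assumes "complete_family I B"
  shows "(\<Sum>k\<in>I. (X ** B k ** Y) $ a $ c * cnj ((X ** B k ** Y) $ a' $ c'))
    = (\<Sum>b\<in>UNIV. \<Sum>d\<in>UNIV. X $ a $ b * Y $ d $ c * cnj (X $ a' $ b * Y $ d $ c'))"
proof -
  \<comment> \<open>Joining the two inner indices into one pair \<open>q\<close> turns completeness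
    into a single Kronecker delta.\<close>
  define f where "f a c q = X $ a $ fst q * Y $ snd q $ c" for a c and q :: "'n \<times> 'n"
  define \<beta> where "\<beta> k q = B k $ fst q $ snd q" for k and q :: "'n \<times> 'n"
  have e: "(X ** B k ** Y) $ a $ c = (\<Sum>q\<in>UNIV. f a c q * \<beta> k q)" for k a c
    unfolding sum_UNIV_prod matrix_matrix_mult_def f_def \<beta>_def
    by (subst sum.swap) (simp add: sum_distrib_left sum_distrib_right mult_ac)
  have \<beta>: "(\<Sum>k\<in>I. \<beta> k q * cnj (\<beta> k q')) = (if q = q' then 1 else 0)" for q q'
    using assms by (auto simp: complete_family_def \<beta>_def prod_eq_iff)
  have "(\<Sum>k\<in>I. (X ** B k ** Y) $ a $ c * cnj ((X ** B k ** Y) $ a' $ c'))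
      = (\<Sum>k\<in>I. \<Sum>q\<in>UNIV. \<Sum>q'\<in>UNIV. f a c q * cnj (f a' c' q') * (\<beta> k q * cnj (\<beta> k q')))"
    unfolding e by (simp add: sum_product mult_ac)
  also have "\<dots> = (\<Sum>q\<in>UNIV. \<Sum>k\<in>I. \<Sum>q'\<in>UNIV. f a c q * cnj (f a' c' q') * (\<beta> k q * cnj (\<beta> k q')))"
    by (rule sum.swap)
  also have "\<dots> = (\<Sum>q\<in>UNIV. \<Sum>q'\<in>UNIV. \<Sum>k\<in>I. f a c q * cnj (f a' c' q') * (\<beta> k q * cnj (\<beta> k q')))"
    by (rule sum.cong[OF refl], rule sum.swap)
  also have "\<dots> = (\<Sum>q\<in>UNIV. \<Sum>q'\<in>UNIV. f a c q * cnj (f a' c' q') * (if q = q' then 1 else 0))"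
    by (simp only: \<beta> flip: sum_distrib_left)
  also have "\<dots> = (\<Sum>q\<in>UNIV. f a c q * cnj (f a' c' q))"
    by (simp add: if_distrib cong: if_cong)
  finally show ?thesis by (simp add: sum_UNIV_prod f_def)
qed

text \<open>The sandwich formula factors into row relations of \<open>G\<close> and column relations
  of \<open>H\<close>. This allows a Bell basis to be rotated to the Schmidt bases.\<close>

lemma complete_family_unitary:
  assumes "complete_family I B" "unitary G" "unitary H"
  shows "complete_family I (\<lambda>k. G ** B k ** H)"
proof -
  have g: "(\<Sum>b\<in>UNIV. G $ a $ b * cnj (G $ a' $ b)) = (if a = a' then 1 else 0)" for a a'
    using unitary_right[OF assms(2)] by (simp add: vec_eq_iff matrix_matrix_mult_def mat_def)
  have "(\<Sum>d\<in>UNIV. cnj (H $ d $ c') * H $ d $ c) = (if c' = c then 1 else 0)" for c c'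
    using assms(3) by (simp add: unitary_def vec_eq_iff matrix_matrix_mult_def mat_def)
  then have h: "(\<Sum>d\<in>UNIV. H $ d $ c * cnj (H $ d $ c')) = (if c = c' then 1 else 0)" for c c'
    by (simp add: mult.commute eq_commute)
  have "(\<Sum>b\<in>UNIV. \<Sum>d\<in>UNIV. G $ a $ b * H $ d $ c * cnj (G $ a' $ b * H $ d $ c'))
      = (\<Sum>b\<in>UNIV. G $ a $ b * cnj (G $ a' $ b)) * (\<Sum>d\<in>UNIV. H $ d $ c * cnj (H $ d $ c'))" for a a' c c'
    by (simp add: sum_product mult_ac)
  then show ?thesis using assms(1)
    by (simp add: complete_family_def[of I "\<lambda>k. G ** B k ** H"] complete_family_sandwich[OF assms(1)] g h)
       (simp add: complete_family_def)
qed

definition vec_of :: "complex^'b::finite^'a::finite \<Rightarrow> complex^('a \<times> 'b)" where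
  "vec_of M = (\<chi> r. M $ fst r $ snd r)"

lemma mat_of_vec_of [simp]: "mat_of (vec_of M) = M"
  by (simp add: vec_eq_iff vec_of_def)

lemma trace_ket_bra: "trace (ket_bra v) = of_real ((norm v)\<^sup>2)"
  by (simp only: cinner_self[symmetric]) (simp add: trace_def cinner_def mult.commute)

text \<open>Up to conjugating the basis, \<open>v k\<close> is the unnormalized state left on
  \<open>AC\<close> by outcome \<open>k\<close> of a measurement of \<open>BD\<close>.\<close>

lemma noa_ge_complete_family:
  fixes \<phi> \<psi> :: "complex^('n::finite \<times> 'n)"
  assumes B: "complete_family I B" and "norm \<phi> = 1" "norm \<psi> = 1"
  shows "((\<Sum>k\<in>I. (nuclear_norm (mat_of \<phi> ** B k ** transpose (mat_of \<psi>)))\<^sup>2) - 1) / (real CARD('n) - 1)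
    \<le> noa (partial_trace_BD (ket_bra (tensor \<phi> \<psi>)))"
proof -
  let ?\<rho> = "partial_trace_BD (ket_bra (tensor \<phi> \<psi>))"
  define v where "v k = vec_of (mat_of \<phi> ** B k ** transpose (mat_of \<psi>))" for k
  have fin: "finite I" using B by (simp add: complete_family_def)
  have "(\<Sum>k\<in>I. ket_bra (v k)) $ r $ s = ?\<rho> $ r $ s" for r s
    by (simp add: v_def vec_of_def complete_family_sandwich[OF B])
       (simp add: partial_trace_BD_def tensor_def transpose_def)
  then have \<rho>: "?\<rho> = (\<Sum>k\<in>I. ket_bra (v k))" by (simp add: vec_eq_iff)
  \<comment> \<open>The outcome probabilities sum to the trace of the reduced state, which factors
    into the squared norms of \<open>\<phi>\<close> and \<open>\<psi>\<close>.\<close>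
  have "complex_of_real (\<Sum>k\<in>I. (norm (v k))\<^sup>2) = (\<Sum>k\<in>I. trace (ket_bra (v k)))"
    by (simp add: trace_ket_bra)
  also have "\<dots> = trace ?\<rho>"
    unfolding \<rho> trace_def sum_component by (rule sum.swap)
  also have "\<dots> = (\<Sum>a\<in>UNIV. \<Sum>c\<in>UNIV. (\<Sum>b\<in>UNIV. \<phi> $ (a, b) * cnj (\<phi> $ (a, b)))
      * (\<Sum>d\<in>UNIV. \<psi> $ (c, d) * cnj (\<psi> $ (c, d))))"
    by (simp add: trace_def partial_trace_BD_def tensor_def sum_UNIV_prod sum_product mult_ac)
  also have "\<dots> = trace (ket_bra \<phi>) * trace (ket_bra \<psi>)"
    by (simp add: trace_def sum_UNIV_prod flip: sum_product)
  also have "\<dots> = complex_of_real 1" by (simp add: trace_ket_bra assms)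
  finally have "(\<Sum>k\<in>I. (norm (v k))\<^sup>2) = 1" using of_real_eq_iff by blast
  from noa_ge[OF ensemble_average_negativity[OF fin \<rho> this]] show ?thesis by (simp add: v_def)
qed

section \<open>Shifts, phases and the completeness of the Weyl matrices\<close>

lemma latin_square:
  obtains \<sigma> :: "nat \<Rightarrow> 'n::finite \<Rightarrow> 'n"
  where "\<And>a. inj (\<sigma> a)" "\<And>i. bij_betw (\<lambda>a. \<sigma> a i) {..<CARD('n)} UNIV" "\<And>i. \<sigma> 0 i = i"
proof -
  let ?d = "CARD('n)"
  obtain h :: "'n \<Rightarrow> nat" where h: "bij_betw h UNIV {0..<?d}"
    using ex_bij_betw_finite_nat[of "UNIV :: 'n set"] by auto
  define g where "g = inv h"
  have hd: "h i < ?d" for i using h by (auto simp: bij_betw_def)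
  have inj: "inj h" using h by (simp add: bij_betw_def)
  have gh: "g (h i) = i" for i by (simp add: g_def inj)
  have hg: "h (g m) = m" if "m < ?d" for m
    using h that unfolding g_def bij_betw_def by (metis atLeast0LessThan f_inv_into_f lessThan_iff)
  \<comment> \<open>Cyclic shifts, carried to the index type by the enumeration
    \<open>h\<close>.\<close>
  define \<sigma> where "\<sigma> a i = g ((h i + a) mod ?d)" for a i
  have h\<sigma>: "h (\<sigma> a i) = (h i + a) mod ?d" for a i
    unfolding \<sigma>_def by (rule hg) (simp add: card_gt_0_iff)
  \<comment> \<open>Cancellation modulo \<open>d\<close> serves twice: for injectivity of each shift
    and for injectivity in the shift amount.\<close>
  have canc: "x = y" if "(m + x) mod ?d = (m + y) mod ?d" "x < ?d" "y < ?d" for m x y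
  proof -
    have "x' = y'" if "x' \<le> y'" "(m + y') mod ?d = (m + x') mod ?d" "y' < ?d" for x' y'
    proof -
      have "?d dvd y' - x'" using that(1,2) by (subst (asm) mod_eq_dvd_iff_nat) auto
      moreover have "y' - x' < ?d" using that(3) by simp
      ultimately have "y' - x' = 0" using nat_dvd_not_less by blast
      then show ?thesis using that(1) by simp
    qed
    from this[of x y] this[of y x] show ?thesis using that by (cases "x \<le> y") simp_all
  qed
  have "inj (\<sigma> a)" for a
  proof (rule injI)
    fix i j assume "\<sigma> a i = \<sigma> a j"
    then have "(a + h i) mod ?d = (a + h j) mod ?d" by (metis h\<sigma> add.commute)
    then show "i = j" using canc hd inj by (meson injD)
  qed
  moreover have "bij_betw (\<lambda>a. \<sigma> a i) {..<?d} UNIV" for i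
  proof -
    have "inj_on (\<lambda>a. \<sigma> a i) {..<?d}"
    proof (rule inj_onI)
      fix a b assume "a \<in> {..<?d}" "b \<in> {..<?d}" "\<sigma> a i = \<sigma> b i"
      then show "a = b" using canc[of "h i" a b] by (metis h\<sigma> lessThan_iff)
    qed
    moreover from this have "(\<lambda>a. \<sigma> a i) ` {..<?d} = UNIV"
      by (intro card_subset_eq) (auto simp: card_image)
    ultimately show ?thesis by (simp add: bij_betw_def)
  qed
  moreover have "\<sigma> 0 i = i" for i by (simp add: \<sigma>_def gh hd)
  ultimately show thesis using that by blast
qed

lemma distinct_roots_of_unity:
  obtains \<zeta> :: "'n::finite \<Rightarrow> complex"
  where "inj \<zeta>" "\<And>i. \<zeta> i ^ CARD('n) = 1" "\<And>i. norm (\<zeta> i) = 1"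
proof -
  let ?d = "CARD('n)"
  obtain h :: "'n \<Rightarrow> nat" where h: "bij_betw h UNIV {0..<?d}"
    using ex_bij_betw_finite_nat[of "UNIV :: 'n set"] by auto
  define \<zeta> where "\<zeta> i = cis (2 * pi * real (h i) / real ?d)" for i
  have bij: "bij_betw (\<lambda>k. cis (2 * pi * real k / real ?d)) {..<?d} {z. z ^ ?d = 1}"
    using Complex.bij_betw_roots_unity[of ?d] by (simp add: card_gt_0_iff)
  have hd: "h i \<in> {..<?d}" for i using h by (auto simp: bij_betw_def)
  have "inj \<zeta>"
    unfolding \<zeta>_def
    by (rule injI) (use h in \<open>auto simp: bij_betw_def dest: injD dest!: inj_onD[OF bij_betw_imp_inj_on[OF bij] _ hd hd]\<close>)
  moreover have "\<zeta> i ^ ?d = 1" for i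
    using bij hd[of i] by (auto simp: \<zeta>_def bij_betw_def)
  ultimately show thesis using that[of \<zeta>] by (simp add: \<zeta>_def)
qed

definition diag :: "('n::finite \<Rightarrow> real) \<Rightarrow> complex^'n^'n" where
  "diag x = (\<chi> i j. if i = j then complex_of_real (x i) else 0)"

lemma diag_mul_left: "(diag x ** A) $ i $ j = of_real (x i) * A $ i $ j"
proof -
  have "(diag x ** A) $ i $ j = (\<Sum>k\<in>UNIV. if k = i then of_real (x i) * A $ i $ j else 0)"
    unfolding matrix_matrix_mult_def vec_lambda_beta by (rule sum.cong) (auto simp: diag_def)
  then show ?thesis by simp
qed

lemma diag_mul_right: "(A ** diag x) $ i $ j = A $ i $ j * of_real (x j)"
proof -
  have "(A ** diag x) $ i $ j = (\<Sum>k\<in>UNIV. if k = j then A $ i $ j * of_real (x j) else 0)"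
    unfolding matrix_matrix_mult_def vec_lambda_beta by (rule sum.cong) (auto simp: diag_def)
  then show ?thesis by simp
qed

text \<open>Diagonal entries of a unitary have real part at most 1, and the identity reaches this
  bound.\<close>

lemma nuclear_norm_diag:
  assumes "\<And>i. 0 \<le> x i" shows "nuclear_norm (diag x) = (\<Sum>i\<in>UNIV. x i)"
proof (rule antisym)
  show "nuclear_norm (diag x) \<le> (\<Sum>i\<in>UNIV. x i)"
  proof (rule nuclear_norm_leI)
    fix V :: "complex^'a^'a" assume "unitary V"
    then have "Re (V $ i $ i) \<le> 1" for i
      using unitary_entry_le[of V i i] complex_Re_le_cmod[of "V $ i $ i"] by linarith
    then have "Re (V $ i $ i) * x i \<le> x i" for i
      using assms[of i] mult_right_mono[of "Re (V $ i $ i)" 1 "x i"] by simp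
    then show "Re (trace (V ** diag x)) \<le> (\<Sum>i\<in>UNIV. x i)"
      by (simp add: trace_def diag_mul_right sum_mono)
  qed
  show "(\<Sum>i\<in>UNIV. x i) \<le> nuclear_norm (diag x)"
    using trace_le_nuclear_norm[OF unitary_mat_1, of "diag x"] by (simp add: trace_def diag_def)
qed

text \<open>A power of the diagonal clock matrix times a permutation matrix; cyclic shifts and roots
  of unity give the Heisenberg-Weyl matrices.\<close>

definition weyl :: "('n::finite \<Rightarrow> 'n) \<Rightarrow> ('n \<Rightarrow> complex) \<Rightarrow> nat \<Rightarrow> complex^'n^'n" where
  "weyl \<tau> \<zeta> k = (\<chi> i j. if j = \<tau> i then \<zeta> i ^ k else 0)"

lemma unit_mult_cnj: "norm (z::complex) = 1 \<Longrightarrow> z * cnj z = 1"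
  by (simp flip: complex_norm_square)

lemma unitary_weyl:
  assumes "inj \<tau>" "\<And>i. norm (\<zeta> i) = 1"
  shows "unitary (weyl \<tau> \<zeta> k)"
proof -
  let ?W = "weyl \<tau> \<zeta> k"
  have "(?W ** conj_transpose ?W) $ i $ j = mat 1 $ i $ j" for i j
  proof -
    have "(?W ** conj_transpose ?W) $ i $ j
        = (\<Sum>l\<in>UNIV. if l = \<tau> i then (if i = j then \<zeta> i ^ k * cnj (\<zeta> i ^ k) else 0) else 0)"
      unfolding matrix_matrix_mult_def vec_lambda_beta
      by (rule sum.cong) (use assms(1) in \<open>auto simp: weyl_def dest: injD\<close>)
    also have "\<dots> = mat 1 $ i $ j"
      using unit_mult_cnj[of "\<zeta> i ^ k"] by (auto simp: mat_def norm_power assms(2))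
    finally show ?thesis .
  qed
  then have "?W ** conj_transpose ?W = mat 1" by (simp add: vec_eq_iff)
  then show ?thesis unfolding unitary_def using matrix_left_right_inverse by blast
qed

text \<open>Summing over the phases \<open>k\<close> forces equal rows; then exactly one shift
  \<open>a\<close> takes row \<open>b\<close> to column \<open>c\<close>.\<close>

lemma complete_family_weyl:
  fixes \<sigma> :: "nat \<Rightarrow> 'n::finite \<Rightarrow> 'n"
  assumes \<sigma>: "\<And>i. bij_betw (\<lambda>a. \<sigma> a i) {..<CARD('n)} UNIV"
    and \<zeta>: "inj \<zeta>" "\<And>i. \<zeta> i ^ CARD('n) = 1" "\<And>i. norm (\<zeta> i) = 1"
  shows "complete_family ({..<CARD('n)} \<times> {..<CARD('n)})
    (\<lambda>(a, k). (1 / sqrt (real CARD('n))) *\<^sub>R weyl (\<sigma> a) \<zeta> k)"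
proof -
  let ?d = "CARD('n)"
  have d0: "0 < real ?d" by (simp add: card_gt_0_iff)
  have ph: "(\<Sum>k<?d. \<zeta> b ^ k * cnj (\<zeta> b' ^ k)) = (if b = b' then of_nat ?d else 0)" for b b'
  proof -
    define z where "z = \<zeta> b * cnj (\<zeta> b')"
    have s: "(\<Sum>k<?d. \<zeta> b ^ k * cnj (\<zeta> b' ^ k)) = (\<Sum>k<?d. z ^ k)"
      by (simp add: z_def power_mult_distrib)
    show ?thesis
    proof (cases "b = b'")
      case True
      then have "z = 1" by (simp add: z_def unit_mult_cnj \<zeta>(3))
      then show ?thesis using True s by simp
    next
      case False
      \<comment> \<open>The ratio of two distinct roots of unity is a nontrivial one, so its
        geometric sum vanishes.\<close>
      have "z * \<zeta> b' = \<zeta> b" by (simp add: z_def unit_mult_cnj \<zeta>(3) mult_ac)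
      then have "z \<noteq> 1" using False injD[OF \<zeta>(1)] by auto
      moreover have "z ^ ?d = 1" using \<zeta>(2) by (simp add: z_def power_mult_distrib flip: complex_cnj_power)
      ultimately show ?thesis using False s by (simp add: sum_gp_strict)
    qed
  qed
  have "(\<Sum>p\<in>{..<?d} \<times> {..<?d}.
      (case p of (a, k) \<Rightarrow> (1 / sqrt (real ?d)) *\<^sub>R weyl (\<sigma> a) \<zeta> k) $ b $ c *
      cnj ((case p of (a, k) \<Rightarrow> (1 / sqrt (real ?d)) *\<^sub>R weyl (\<sigma> a) \<zeta> k) $ b' $ c'))
      = (if b = b' \<and> c = c' then 1 else 0)" (is "?L = _") for b b' c c'
  proof -
    have "?L = (\<Sum>a<?d. \<Sum>k<?d. ((1 / sqrt (real ?d)) *\<^sub>R weyl (\<sigma> a) \<zeta> k) $ b $ c *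
        cnj (((1 / sqrt (real ?d)) *\<^sub>R weyl (\<sigma> a) \<zeta> k) $ b' $ c'))"
      by (simp only: sum.cartesian_product case_prod_unfold)
    also have "\<dots> = (\<Sum>a<?d. \<Sum>k<?d. (if c = \<sigma> a b \<and> c' = \<sigma> a b' then
        of_real (1 / real ?d) * (\<zeta> b ^ k * cnj (\<zeta> b' ^ k)) else 0))"
      by (intro sum.cong refl)
         (auto simp: weyl_def scaleR_conv_of_real[where 'a=complex] simp flip: of_real_mult)
    also have "\<dots> = (\<Sum>a<?d. (if c = \<sigma> a b \<and> c' = \<sigma> a b' then
        of_real (1 / real ?d) * (\<Sum>k<?d. \<zeta> b ^ k * cnj (\<zeta> b' ^ k)) else 0))"
      by (intro sum.cong refl) (auto simp: sum_distrib_left)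
    also have "\<dots> = (\<Sum>a<?d. (if c = \<sigma> a b then (if b = b' \<and> c = c' then 1 else 0) else 0))"
      unfolding ph using d0 by (intro sum.cong refl) auto
    \<comment> \<open>For fixed \<open>b\<close> the shifts run through each column once.\<close>
    also have "\<dots> = (\<Sum>j\<in>UNIV. (if c = j then (if b = b' \<and> c = c' then 1 else 0) else 0))"
      by (rule sum.reindex_bij_betw[OF \<sigma>])
    finally show ?thesis by simp
  qed
  then show ?thesis by (simp add: complete_family_def)
qed

text \<open>The adjoint of the Weyl matrix is the test unitary: it cancels all phases.\<close>

lemma nuclear_norm_diag_weyl_diag:
  assumes "inj \<tau>" "\<And>i. norm (\<zeta> i) = 1"
  shows "(\<Sum>i\<in>UNIV. x i * y (\<tau> i)) \<le> nuclear_norm (diag x ** weyl \<tau> \<zeta> k ** diag y)"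
proof -
  let ?W = "weyl \<tau> \<zeta> k"
  have "trace (conj_transpose ?W ** (diag x ** ?W ** diag y))
      = (\<Sum>j\<in>UNIV. \<Sum>i\<in>UNIV. cnj (?W $ i $ j) * (of_real (x i) * ?W $ i $ j * of_real (y j)))"
    by (simp add: trace_def matrix_matrix_mult_def[of "conj_transpose ?W"] diag_mul_left diag_mul_right)
  also have "\<dots> = (\<Sum>i\<in>UNIV. \<Sum>j\<in>UNIV. if j = \<tau> i then of_real (x i * y (\<tau> i)) else 0)"
  proof (subst sum.swap, intro sum.cong refl)
    fix i j
    have "cnj (\<zeta> i ^ k) * \<zeta> i ^ k = 1"
      using unit_mult_cnj[of "\<zeta> i ^ k"] by (simp add: norm_power assms(2) mult.commute)
    then show "cnj (?W $ i $ j) * (of_real (x i) * ?W $ i $ j * of_real (y j))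
        = (if j = \<tau> i then of_real (x i * y (\<tau> i)) else 0)"
      by (simp add: weyl_def mult_ac)
  qed
  also have "\<dots> = of_real (\<Sum>i\<in>UNIV. x i * y (\<tau> i))" by simp
  finally show ?thesis
    using trace_le_nuclear_norm[OF unitary_conj_transpose[OF unitary_weyl[of \<tau> \<zeta> k, OF assms]],
        where A = "diag x ** ?W ** diag y"] by simp
qed

section \<open>Schmidt decompositions as matrix factorizations\<close>

lemma schmidt_decomposition_matrix:
  assumes "schmidt_coefficients \<phi> l"
  obtains E F where "unitary E" "unitary F" "mat_of \<phi> = E ** diag (\<lambda>i. sqrt (l i)) ** F"
proof -
  obtain e f where o: "orthonormal_basis e" "orthonormal_basis f"
    and \<phi>: "\<phi> = (\<Sum>i\<in>UNIV. sqrt (l i) *\<^sub>R tensor (e i) (f i))"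
    using assms unfolding schmidt_coefficients_def by blast
  have u: "unitary (\<chi> a i. g i $ a)" if "orthonormal_basis g" for g :: "'a \<Rightarrow> complex^'a"
    using that by (simp add: unitary_def orthonormal_basis_def cinner_def vec_eq_iff
        matrix_matrix_mult_def mat_def)
  \<comment> \<open>The second basis enters as rows, without conjugation, because
    \<open>tensor\<close> is bilinear.\<close>
  have "transpose (\<chi> a i. f i $ a) = (\<chi> i a. f i $ a)"
    by (simp add: vec_eq_iff transpose_def)
  then have "unitary (\<chi> i a. f i $ a)" using unitary_transpose[OF u[OF o(2)]] by simp
  moreover have "mat_of \<phi> = (\<chi> a i. e i $ a) ** diag (\<lambda>i. sqrt (l i)) ** (\<chi> i a. f i $ a)"
    by (simp add: vec_eq_iff matrix_matrix_mult_def[of "_ ** _"] diag_mul_right \<phi> tensor_def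
        scaleR_conv_of_real[where 'a=complex] mult_ac)
  ultimately show thesis using that u[OF o(1)] by blast
qed

text \<open>Relabelling both bases by the inverse permutation lets two states share one coefficient
  list.\<close>

lemma schmidt_coefficients_permute:
  assumes "schmidt_coefficients \<psi> (l \<circ> \<pi>)" "bij \<pi>"
  shows "schmidt_coefficients \<psi> l"
proof -
  obtain e f where o: "orthonormal_basis e" "orthonormal_basis f"
    and \<psi>: "\<psi> = (\<Sum>i\<in>UNIV. sqrt (l (\<pi> i)) *\<^sub>R tensor (e i) (f i))"
    using assms(1) unfolding schmidt_coefficients_def by auto
  have "inj (inv \<pi>)" using assms(2) by (simp add: bij_imp_bij_inv bij_is_inj)
  then have "orthonormal_basis (e \<circ> inv \<pi>)" "orthonormal_basis (f \<circ> inv \<pi>)"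
    using o by (auto simp: orthonormal_basis_def dest: injD)
  moreover have "\<psi> = (\<Sum>i\<in>UNIV. sqrt (l i) *\<^sub>R tensor ((e \<circ> inv \<pi>) i) ((f \<circ> inv \<pi>) i))"
    unfolding \<psi> using assms(2)
    by (subst sum.reindex_bij_betw[OF assms(2), symmetric]) (simp add: bij_is_inj)
  moreover have "0 \<le> l i" for i
    using assms unfolding schmidt_coefficients_def by (metis bij_pointE comp_apply)
  moreover have "(\<Sum>i\<in>UNIV. l i) = 1"
    using assms sum.reindex_bij_betw[OF assms(2), of l] by (simp add: schmidt_coefficients_def)
  ultimately show ?thesis unfolding schmidt_coefficients_def by blast
qed

lemma nuclear_norm_schmidt:
  assumes "schmidt_coefficients \<phi> l"
  shows "nuclear_norm (mat_of \<phi>) = (\<Sum>i\<in>UNIV. sqrt (l i))"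
proof -
  obtain E F where "unitary E" "unitary F" "mat_of \<phi> = E ** diag (\<lambda>i. sqrt (l i)) ** F"
    using schmidt_decomposition_matrix[OF assms] .
  then show ?thesis
    using assms by (simp add: nuclear_norm_unitary_left nuclear_norm_unitary_right
        nuclear_norm_diag schmidt_coefficients_def)
qed

text \<open>All singular values coincide, so the diagonal factor is scalar.\<close>

lemma maximally_entangled_matrix:
  fixes \<psi> :: "complex^('n::finite \<times> 'n)"
  assumes "maximally_entangled \<psi>"
  obtains U where "unitary U" "mat_of \<psi> = (1 / sqrt (real CARD('n))) *\<^sub>R U"
proof -
  obtain E F where EF: "unitary E" "unitary F"
    "mat_of \<psi> = E ** diag (\<lambda>i. sqrt (1 / real CARD('n))) ** F"
    using schmidt_decomposition_matrix assms unfolding maximally_entangled_def by blast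
  have "diag (\<lambda>i::'n. c) = c *\<^sub>R mat 1" for c
    by (simp add: vec_eq_iff diag_def mat_def scaleR_conv_of_real[where 'a=complex])
  then have "mat_of \<psi> = (1 / sqrt (real CARD('n))) *\<^sub>R (E ** F)"
    by (simp add: EF(3) matrix_mul_scaleR_right matrix_mul_scaleR_left real_sqrt_divide)
  then show thesis using that unitary_mul[OF EF(1,2)] by blast
qed

lemma cren_maximally_entangled:
  fixes \<psi> :: "complex^('n::finite \<times> 'n)"
  assumes "maximally_entangled \<psi>" "norm \<psi> = 1" "CARD('n) \<ge> 2"
  shows "cren (ket_bra \<psi>) = 1"
proof -
  \<comment> \<open>There are \<open>d\<close> summands \<open>sqrt (1 / d)\<close>; the square
    minus 1 is the positive normalizing denominator.\<close>
  have "nuclear_norm (mat_of \<psi>) = sqrt (real CARD('n))"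
    using nuclear_norm_schmidt[OF assms(1)[unfolded maximally_entangled_def]]
    by (simp add: real_sqrt_divide real_div_sqrt)
  then show ?thesis using assms by (simp add: cren_pure negativity_pure)
qed

section \<open>The lower bounds for the three cases\<close>

lemma complete_family_of_unitaries:
  obtains W :: "nat \<times> nat \<Rightarrow> complex^'n::finite^'n" where "\<And>p. unitary (W p)"
    "complete_family ({..<CARD('n)} \<times> {..<CARD('n)}) (\<lambda>p. (1 / sqrt (real CARD('n))) *\<^sub>R W p)"
proof -
  obtain \<sigma> :: "nat \<Rightarrow> 'n \<Rightarrow> 'n" where \<sigma>: "\<And>a. inj (\<sigma> a)"
    "\<And>i. bij_betw (\<lambda>a. \<sigma> a i) {..<CARD('n)} UNIV" "\<And>i. \<sigma> 0 i = i"
    using latin_square by blast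
  obtain \<zeta> :: "'n \<Rightarrow> complex" where \<zeta>: "inj \<zeta>" "\<And>i. \<zeta> i ^ CARD('n) = 1" "\<And>i. norm (\<zeta> i) = 1"
    using distinct_roots_of_unity by blast
  show thesis
  proof (rule that[of "\<lambda>p. weyl (\<sigma> (fst p)) \<zeta> (snd p)"])
    show "unitary (weyl (\<sigma> (fst p)) \<zeta> (snd p))" for p
      by (intro unitary_weyl \<sigma> \<zeta>)
    show "complete_family ({..<CARD('n)} \<times> {..<CARD('n)})
        (\<lambda>p. (1 / sqrt (real CARD('n))) *\<^sub>R weyl (\<sigma> (fst p)) \<zeta> (snd p))"
      using complete_family_weyl[of \<sigma> \<zeta>, OF \<sigma>(2) \<zeta>] by (simp add: case_prod_unfold)
  qed
qed

text \<open>The basis and \<open>\<psi>\<close> each contribute a unitary over the root of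
  \<open>d\<close>. Each of the \<open>d * d\<close> outcomes thus has the nuclear norm of
  \<open>\<phi>\<close> over \<open>d\<close>, and the squares sum to the undivided square.\<close>

lemma noa_ge_cren_left:
  fixes \<phi> \<psi> :: "complex^('n::finite \<times> 'n)"
  assumes "maximally_entangled \<psi>" "norm \<phi> = 1" "norm \<psi> = 1"
  shows "cren (ket_bra \<phi>) \<le> noa (partial_trace_BD (ket_bra (tensor \<phi> \<psi>)))"
proof -
  let ?d = "CARD('n)"
  obtain W :: "nat \<times> nat \<Rightarrow> complex^'n^'n" where W: "\<And>p. unitary (W p)"
    "complete_family ({..<?d} \<times> {..<?d}) (\<lambda>p. (1 / sqrt (real ?d)) *\<^sub>R W p)"
    using complete_family_of_unitaries by blast
  obtain U where U: "unitary U" "mat_of \<psi> = (1 / sqrt (real ?d)) *\<^sub>R U"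
    using maximally_entangled_matrix assms(1) by blast
  have tr: "transpose (c *\<^sub>R U) = c *\<^sub>R transpose U" for c
    by (simp add: vec_eq_iff transpose_def)
  have "nuclear_norm (mat_of \<phi> ** ((1 / sqrt (real ?d)) *\<^sub>R W p) ** transpose (mat_of \<psi>))
      = nuclear_norm (mat_of \<phi>) / real ?d" for p
    by (simp add: U W(1) tr matrix_mul_scaleR_right matrix_mul_scaleR_left nuclear_norm_scaleR
        nuclear_norm_unitary_right unitary_transpose)
  then have "(\<Sum>p\<in>{..<?d} \<times> {..<?d}. (nuclear_norm (mat_of \<phi> **
      ((1 / sqrt (real ?d)) *\<^sub>R W p) ** transpose (mat_of \<psi>)))\<^sup>2) = (nuclear_norm (mat_of \<phi>))\<^sup>2"
    by (simp add: card_cartesian_product power2_eq_square)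
  then show ?thesis
    using noa_ge_complete_family[OF W(2) assms(2,3)] by (simp add: cren_pure negativity_pure assms)
qed

text \<open>The mirror image: the unitaries now stand on the left of the transpose of
  \<open>mat_of \<psi>\<close>, which has the nuclear norm of \<open>mat_of \<psi>\<close>.\<close>

lemma noa_ge_cren_right:
  fixes \<phi> \<psi> :: "complex^('n::finite \<times> 'n)"
  assumes "maximally_entangled \<phi>" "norm \<phi> = 1" "norm \<psi> = 1"
  shows "cren (ket_bra \<psi>) \<le> noa (partial_trace_BD (ket_bra (tensor \<phi> \<psi>)))"
proof -
  let ?d = "CARD('n)"
  obtain W :: "nat \<times> nat \<Rightarrow> complex^'n^'n" where W: "\<And>p. unitary (W p)"
    "complete_family ({..<?d} \<times> {..<?d}) (\<lambda>p. (1 / sqrt (real ?d)) *\<^sub>R W p)"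
    using complete_family_of_unitaries by blast
  obtain U where U: "unitary U" "mat_of \<phi> = (1 / sqrt (real ?d)) *\<^sub>R U"
    using maximally_entangled_matrix assms(1) by blast
  have "nuclear_norm (mat_of \<phi> ** ((1 / sqrt (real ?d)) *\<^sub>R W p) ** transpose (mat_of \<psi>))
      = nuclear_norm (mat_of \<psi>) / real ?d" for p
    by (simp add: U W(1) matrix_mul_scaleR_right matrix_mul_scaleR_left nuclear_norm_scaleR
        nuclear_norm_unitary_left unitary_mul nuclear_norm_transpose)
  then have "(\<Sum>p\<in>{..<?d} \<times> {..<?d}. (nuclear_norm (mat_of \<phi> **
      ((1 / sqrt (real ?d)) *\<^sub>R W p) ** transpose (mat_of \<psi>)))\<^sup>2) = (nuclear_norm (mat_of \<psi>))\<^sup>2"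
    by (simp add: card_cartesian_product power2_eq_square)
  then show ?thesis
    using noa_ge_complete_family[OF W(2) assms(2,3)] by (simp add: cren_pure negativity_pure assms)
qed

lemma noa_ge_same_schmidt_coefficients:
  fixes \<phi> \<psi> :: "complex^('n::finite \<times> 'n)"
  assumes \<phi>: "schmidt_coefficients \<phi> l" "norm \<phi> = 1"
    and \<psi>: "schmidt_coefficients \<psi> l" "norm \<psi> = 1" and d: "CARD('n) \<ge> 2"
  shows "cren (ket_bra \<phi>) * cren (ket_bra \<psi>) \<le> noa (partial_trace_BD (ket_bra (tensor \<phi> \<psi>)))"
proof -
  let ?d = "CARD('n)"
  obtain \<sigma> :: "nat \<Rightarrow> 'n \<Rightarrow> 'n" where \<sigma>: "\<And>a. inj (\<sigma> a)"
    "\<And>i. bij_betw (\<lambda>a. \<sigma> a i) {..<?d} UNIV" "\<And>i. \<sigma> 0 i = i"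
    using latin_square by blast
  obtain \<zeta> :: "'n \<Rightarrow> complex" where \<zeta>: "inj \<zeta>" "\<And>i. \<zeta> i ^ ?d = 1" "\<And>i. norm (\<zeta> i) = 1"
    using distinct_roots_of_unity by blast
  define x where "x i = sqrt (l i)" for i
  define c where "c a = (\<Sum>i\<in>UNIV. x i * x (\<sigma> a i))" for a
  define s where "s = (\<Sum>i\<in>UNIV. x i)"
  have x0: "0 \<le> x i" for i using \<phi>(1) by (simp add: x_def schmidt_coefficients_def)
  obtain E F where EF: "unitary E" "unitary F" "mat_of \<phi> = E ** diag x ** F"
    using schmidt_decomposition_matrix[OF \<phi>(1)] unfolding x_def .
  obtain E' F' where EF': "unitary E'" "unitary F'" "mat_of \<psi> = E' ** diag x ** F'"
    using schmidt_decomposition_matrix[OF \<psi>(1)] unfolding x_def .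
  define W where "W = (\<lambda>(a, k). (1 / sqrt (real ?d)) *\<^sub>R weyl (\<sigma> a) \<zeta> k)"
  \<comment> \<open>This rotation cancels the inner Schmidt unitaries \<open>F\<close> and
    \<open>F'\<close>; the outer ones do not affect the nuclear norm.\<close>
  define B where "B p = conj_transpose F ** W p ** conj_transpose (transpose F')" for p
  have B: "complete_family ({..<?d} \<times> {..<?d}) B"
    unfolding B_def W_def
    by (intro complete_family_unitary complete_family_weyl unitary_conj_transpose unitary_transpose
        EF EF' \<sigma> \<zeta>)
  have "c a / sqrt (real ?d) \<le> nuclear_norm (mat_of \<phi> ** B (a, k) ** transpose (mat_of \<psi>))" for a k
  proof -
    have td: "transpose (diag x) = diag x" by (simp add: vec_eq_iff transpose_def diag_def)
    have tp: "transpose (mat_of \<psi>) = transpose F' ** (diag x ** transpose E')"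
      by (simp add: EF'(3) matrix_transpose_mul td)
    have f: "F ** conj_transpose F = mat 1" "conj_transpose (transpose F') ** transpose F' = mat 1"
      using unitary_right[OF EF(2)] unitary_transpose[OF EF'(2)] by (simp_all add: unitary_def)
    have "mat_of \<phi> ** B (a, k) ** transpose (mat_of \<psi>)
        = E ** diag x ** (F ** conj_transpose F) ** W (a, k)
          ** (conj_transpose (transpose F') ** transpose F') ** (diag x ** transpose E')"
      unfolding B_def tp EF(3) by (simp only: matrix_mul_assoc)
    also have "\<dots> = E ** (diag x ** W (a, k) ** diag x) ** transpose E'"
      unfolding f by (simp add: matrix_mul_assoc)
    finally have "nuclear_norm (mat_of \<phi> ** B (a, k) ** transpose (mat_of \<psi>))
        = nuclear_norm (diag x ** W (a, k) ** diag x)"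
      by (simp add: nuclear_norm_unitary_left nuclear_norm_unitary_right unitary_transpose EF EF')
    also have "\<dots> = nuclear_norm (diag x ** weyl (\<sigma> a) \<zeta> k ** diag x) / sqrt (real ?d)"
      by (simp add: W_def matrix_mul_scaleR_right matrix_mul_scaleR_left nuclear_norm_scaleR)
    finally show ?thesis
      unfolding c_def using nuclear_norm_diag_weyl_diag[OF \<sigma>(1) \<zeta>(3), where x = x and y = x]
      by (simp add: divide_right_mono)
  qed
  moreover have c0: "0 \<le> c a" for a unfolding c_def by (intro sum_nonneg mult_nonneg_nonneg x0)
  ultimately have "(c a / sqrt (real ?d))\<^sup>2
      \<le> (nuclear_norm (mat_of \<phi> ** B (a, k) ** transpose (mat_of \<psi>)))\<^sup>2" for a k
    by (intro power_mono) simp_all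
  then have "(\<Sum>p\<in>{..<?d} \<times> {..<?d}. (c (fst p) / sqrt (real ?d))\<^sup>2)
      \<le> (\<Sum>p\<in>{..<?d} \<times> {..<?d}. (nuclear_norm (mat_of \<phi> ** B p ** transpose (mat_of \<psi>)))\<^sup>2)"
    by (intro sum_mono) auto
  \<comment> \<open>The \<open>d\<close> phases belonging to each shift compensate the factor
    \<open>1 / d\<close>.\<close>
  moreover have "(\<Sum>p\<in>{..<?d} \<times> {..<?d}. (c (fst p) / sqrt (real ?d))\<^sup>2) = (\<Sum>a<?d. (c a)\<^sup>2)"
  proof -
    have "(\<Sum>p\<in>{..<?d} \<times> {..<?d}. (c (fst p) / sqrt (real ?d))\<^sup>2)
        = (\<Sum>a<?d. \<Sum>k<?d. (c a / sqrt (real ?d))\<^sup>2)"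
      by (simp only: sum.cartesian_product case_prod_unfold)
    then show ?thesis by (simp add: power_divide)
  qed
  ultimately have "((\<Sum>a<?d. (c a)\<^sup>2) - 1) / (real ?d - 1)
      \<le> ((\<Sum>p\<in>{..<?d} \<times> {..<?d}. (nuclear_norm (mat_of \<phi> ** B p ** transpose (mat_of \<psi>)))\<^sup>2) - 1)
        / (real ?d - 1)"
    using d by (intro divide_right_mono diff_right_mono) simp_all
  also have "\<dots> \<le> noa (partial_trace_BD (ket_bra (tensor \<phi> \<psi>)))"
    by (rule noa_ge_complete_family[OF B \<phi>(2) \<psi>(2)])
  finally have a: "((\<Sum>a<?d. (c a)\<^sup>2) - 1) / (real ?d - 1)
      \<le> noa (partial_trace_BD (ket_bra (tensor \<phi> \<psi>)))" .
  have b: "(s\<^sup>2 - 1)\<^sup>2 \<le> ((\<Sum>a<?d. (c a)\<^sup>2) - 1) * (real ?d - 1)"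
  proof -
    have split: "(\<Sum>a<?d. f a) = f 0 + (\<Sum>a\<in>{1..<?d}. f a)" for f :: "nat \<Rightarrow> real"
      using d by (simp add: lessThan_atLeast0 sum.atLeast_Suc_lessThan)
    have "c 0 = (\<Sum>i\<in>UNIV. l i)"
      using x0 \<phi>(1) by (simp add: c_def \<sigma>(3) x_def schmidt_coefficients_def)
    then have c1: "c 0 = 1" using \<phi>(1) by (simp add: schmidt_coefficients_def)
    \<comment> \<open>Over all shifts every product \<open>x i * x j\<close> occurs once, so the
      total is the square of \<open>s\<close>; removing the identity shift, which contributes 1,
      leaves the numerator of the negativity.\<close>
    have "(\<Sum>a<?d. c a) = (\<Sum>i\<in>UNIV. \<Sum>a<?d. x i * x (\<sigma> a i))"
      unfolding c_def by (rule sum.swap)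
    also have "\<dots> = (\<Sum>i\<in>UNIV. x i * s)"
      by (simp add: s_def sum.reindex_bij_betw[OF \<sigma>(2)] flip: sum_distrib_left)
    also have "\<dots> = s\<^sup>2" by (simp add: s_def power2_eq_square sum_distrib_right)
    finally have "s\<^sup>2 - 1 = (\<Sum>a\<in>{1..<?d}. c a)" using split[of c] c1 by simp
    then have "(s\<^sup>2 - 1)\<^sup>2 \<le> (\<Sum>a\<in>{1..<?d}. (c a)\<^sup>2) * real (card {1..<?d})"
      using sum_squared_le_sum_of_squares[of c "{1..<?d}"] by simp
    then show ?thesis using split[of "\<lambda>a. (c a)\<^sup>2"] c1 d by (simp add: of_nat_diff)
  qed
  have e: "cren (ket_bra \<phi>) = (s\<^sup>2 - 1) / (real ?d - 1)" "cren (ket_bra \<psi>) = (s\<^sup>2 - 1) / (real ?d - 1)"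
    using \<phi> \<psi> by (simp_all add: cren_pure negativity_pure nuclear_norm_schmidt s_def x_def)
  have "cren (ket_bra \<phi>) * cren (ket_bra \<psi>) = (s\<^sup>2 - 1)\<^sup>2 / (real ?d - 1) / (real ?d - 1)"
    by (simp add: e power2_eq_square)
  also have "\<dots> \<le> ((\<Sum>a<?d. (c a)\<^sup>2) - 1) / (real ?d - 1)"
    using b d by (intro divide_right_mono) (simp_all add: pos_divide_le_eq)
  finally show ?thesis using a by simp
qed

theorem theorem2:
  fixes \<phi> \<psi> :: "complex^('n::finite \<times> 'n)"
  assumes "CARD('n) \<ge> 2"
    and "norm \<phi> = 1" and "norm \<psi> = 1"
    and "same_schmidt_coefficients \<phi> \<psi> \<or> maximally_entangled \<phi> \<or> maximally_entangled \<psi>"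
  shows "noa (partial_trace_BD (ket_bra (tensor \<phi> \<psi>))) \<ge> cren (ket_bra \<phi>) * cren (ket_bra \<psi>)"
  using assms(4)
proof (elim disjE)
  assume "same_schmidt_coefficients \<phi> \<psi>"
  \<comment> \<open>The permutation is absorbed into the Schmidt bases of
    \<open>\<psi>\<close>.\<close>
  then obtain l where "schmidt_coefficients \<phi> l" "schmidt_coefficients \<psi> l"
    unfolding same_schmidt_coefficients_def using schmidt_coefficients_permute by blast
  then show ?thesis using noa_ge_same_schmidt_coefficients assms(1-3) by blast
next
  assume "maximally_entangled \<phi>"
  \<comment> \<open>The maximally entangled factor has CREN 1, so the product is the CREN of the
    other state.\<close>
  then show ?thesis
    using noa_ge_cren_right[of \<phi> \<psi>] cren_maximally_entangled[of \<phi>] assms(1-3) by simp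
next
  assume "maximally_entangled \<psi>"
  then show ?thesis
    using noa_ge_cren_left[of \<psi> \<phi>] cren_maximally_entangled[of \<psi>] assms(1-3) by simp
qed

end
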